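(* Let $(G,\mathcal{B},\mathcal{L},\mathcal{F})$ be a quasi-biased graph such that neither $\mathcal{L}$ nor $\mathcal{F}$ is degenerate, and suppose $M=M(G,\mathcal{B},\mathcal{L},\mathcal{F})$ is simple and connected. If $M$ is not $3$-connected, then $M$ is not unbreakable.
   Context: Graphs are finite with loops and parallel edges allowed; cycles include loops and 2-cycles. A quasi-biased graph $(G,\mathcal{B},\mathcal{L},\mathcal{F})$ is a graph $G$ with a partition $(\mathcal{B},\mathcal{L},\mathcal{F})$ of its cycles such that no theta subgraph contains exactly two cycles of $\mathcal{B}$ and every cycle in $\mathcal{L}$ shares a vertex with every cycle in $\mathcal{F}$. $M(G,\mathcal{B},\mathcal{L},\mathcal{F})$ is the matroid on $E(G)$ whose circuits are: cycles in $\mathcal{B}$; theta subgraphs containing no cycle of $\mathcal{B}$; tight handcuffs (two edge-disjoint cycles sharing exactly one vertex) with neither cycle in $\mathcal{B}$; unions of two vertex-disjoint cycles of $\mathcal{L}$; loose handcuffs (two vertex-disjoint cycles plus a minimal path joining them) with both cycles in $\mathcal{F}$. $\mathcal{L}$ (resp. $\mathcal{F}$) is degenerate if it contains no two vertex-disjoint cycles. A matroid is unbreakable if it is connected and $M/F$ is connected for every flat $F$. *)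

theory Defs
  imports Main
begin

section \<open>Graphs with loops and parallel edges\<close>

record ('v, 'e) multigraph =
  verts :: "'v set"
  edges :: "'e set"
  ends :: "'e \<Rightarrow> 'v set"

text \<open>A loop is an edge whose set of ends is a singleton.\<close>

definition finite_multigraph :: "('v, 'e) multigraph \<Rightarrow> bool" where
  "finite_multigraph G \<longleftrightarrow>
     finite (verts G) \<and> finite (edges G) \<and>
     (\<forall>e \<in> edges G. ends G e \<subseteq> verts G \<and> card (ends G e) \<in> {1, 2})"

text \<open>Cycles, theta subgraphs and handcuffs have no isolated vertices, so they are identified
  with their edge sets; \<open>vertex_set G X\<close> recovers the vertices.\<close>

definition vertex_set :: "('v, 'e) multigraph \<Rightarrow> 'e set \<Rightarrow> 'v set" where
  "vertex_set G X = (\<Union>e \<in> X. ends G e)"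

abbreviation vertex_disjoint :: "('v, 'e) multigraph \<Rightarrow> 'e set \<Rightarrow> 'e set \<Rightarrow> bool" where
  "vertex_disjoint G X Y \<equiv> vertex_set G X \<inter> vertex_set G Y = {}"

text \<open>\<open>vs\<close> and \<open>es\<close> list the vertices and the edges of the path in order; its ends are
  \<open>hd vs\<close> and \<open>last vs\<close>. Single-vertex paths (\<open>es = []\<close>) are included.\<close>

definition is_path :: "('v, 'e) multigraph \<Rightarrow> 'v list \<Rightarrow> 'e list \<Rightarrow> bool" where
  "is_path G vs es \<longleftrightarrow>
     length vs = Suc (length es) \<and> distinct vs \<and>
     set vs \<subseteq> verts G \<and> set es \<subseteq> edges G \<and>
     (\<forall>i < length es. ends G (es ! i) = {vs ! i, vs ! Suc i})"

text \<open>A cycle is a path together with one further edge joining the ends of the path: a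
  single-vertex path gives a loop, a path with one edge gives a 2-cycle.\<close>

definition is_cycle :: "('v, 'e) multigraph \<Rightarrow> 'e set \<Rightarrow> bool" where
  "is_cycle G C \<longleftrightarrow>
     (\<exists>vs es e. is_path G vs es \<and> e \<in> edges G \<and> e \<notin> set es \<and>
        ends G e = {hd vs, last vs} \<and> C = insert e (set es))"

text \<open>A theta consists of three internally disjoint paths joining two distinct vertices. The
  edge-disjointness condition is only needed for paths with a single edge.\<close>

definition is_theta :: "('v, 'e) multigraph \<Rightarrow> 'e set \<Rightarrow> bool" where
  "is_theta G T \<longleftrightarrow>
     (\<exists>u v vs1 es1 vs2 es2 vs3 es3. u \<noteq> v \<and>
        (\<forall>(vs, es) \<in> {(vs1, es1), (vs2, es2), (vs3, es3)}.
           is_path G vs es \<and> hd vs = u \<and> last vs = v) \<and>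
        set vs1 \<inter> set vs2 = {u, v} \<and> set vs1 \<inter> set vs3 = {u, v} \<and> set vs2 \<inter> set vs3 = {u, v} \<and>
        set es1 \<inter> set es2 = {} \<and> set es1 \<inter> set es3 = {} \<and> set es2 \<inter> set es3 = {} \<and>
        T = set es1 \<union> set es2 \<union> set es3)"

definition is_tight_handcuff :: "('v, 'e) multigraph \<Rightarrow> 'e set \<Rightarrow> 'e set \<Rightarrow> 'e set \<Rightarrow> bool" where
  "is_tight_handcuff G C1 C2 H \<longleftrightarrow>
     is_cycle G C1 \<and> is_cycle G C2 \<and> C1 \<inter> C2 = {} \<and>
     card (vertex_set G C1 \<inter> vertex_set G C2) = 1 \<and>
     H = C1 \<union> C2"

text \<open>A path joining two vertex-disjoint cycles is minimal iff it meets each of them only in an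
  end.\<close>

definition is_loose_handcuff :: "('v, 'e) multigraph \<Rightarrow> 'e set \<Rightarrow> 'e set \<Rightarrow> 'e set \<Rightarrow> bool" where
  "is_loose_handcuff G C1 C2 H \<longleftrightarrow>
     is_cycle G C1 \<and> is_cycle G C2 \<and> vertex_disjoint G C1 C2 \<and>
     (\<exists>vs es. is_path G vs es \<and>
        set vs \<inter> vertex_set G C1 = {hd vs} \<and> set vs \<inter> vertex_set G C2 = {last vs} \<and>
        H = C1 \<union> C2 \<union> set es)"


section \<open>Quasi-biased graphs\<close>

definition quasi_biased_graph ::
  "('v, 'e) multigraph \<Rightarrow> 'e set set \<Rightarrow> 'e set set \<Rightarrow> 'e set set \<Rightarrow> bool" where
  "quasi_biased_graph G \<B> \<L> \<F> \<longleftrightarrow>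
     finite_multigraph G \<and>
     \<B> \<union> \<L> \<union> \<F> = {C. is_cycle G C} \<and>
     \<B> \<inter> \<L> = {} \<and> \<B> \<inter> \<F> = {} \<and> \<L> \<inter> \<F> = {} \<and>
     (\<forall>T. is_theta G T \<longrightarrow> card {C \<in> \<B>. C \<subseteq> T} \<noteq> 2) \<and>
     (\<forall>C \<in> \<L>. \<forall>D \<in> \<F>. vertex_set G C \<inter> vertex_set G D \<noteq> {})"

definition degenerate :: "('v, 'e) multigraph \<Rightarrow> 'e set set \<Rightarrow> bool" where
  "degenerate G \<C> \<longleftrightarrow> \<not> (\<exists>C \<in> \<C>. \<exists>D \<in> \<C>. vertex_disjoint G C D)"


section \<open>Matroids\<close>

record 'e pre_matroid =
  ground :: "'e set"
  indep :: "'e set \<Rightarrow> bool"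

locale matroid =
  fixes M :: "'e pre_matroid"
  assumes finite_ground: "finite (ground M)"
    and indep_subset_ground: "indep M I \<Longrightarrow> I \<subseteq> ground M"
    and indep_empty: "indep M {}"
    and indep_subset: "indep M I \<Longrightarrow> J \<subseteq> I \<Longrightarrow> indep M J"
    and indep_augment: "indep M I \<Longrightarrow> indep M J \<Longrightarrow> card I < card J \<Longrightarrow>
      \<exists>e \<in> J - I. indep M (insert e I)"

definition matroid_circuit :: "'e pre_matroid \<Rightarrow> 'e set \<Rightarrow> bool" where
  "matroid_circuit M C \<longleftrightarrow> C \<subseteq> ground M \<and> \<not> indep M C \<and> (\<forall>D. D \<subset> C \<longrightarrow> indep M D)"

definition matroid_rank :: "'e pre_matroid \<Rightarrow> 'e set \<Rightarrow> nat" where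
  "matroid_rank M X = Max {card I | I. I \<subseteq> X \<and> indep M I}"

text \<open>A maximal independent subset of \<open>X\<close>.\<close>

definition matroid_basis_of :: "'e pre_matroid \<Rightarrow> 'e set \<Rightarrow> 'e set \<Rightarrow> bool" where
  "matroid_basis_of M X I \<longleftrightarrow>
     I \<subseteq> X \<and> indep M I \<and> (\<forall>J. I \<subseteq> J \<and> J \<subseteq> X \<and> indep M J \<longrightarrow> J = I)"

definition matroid_closure :: "'e pre_matroid \<Rightarrow> 'e set \<Rightarrow> 'e set" where
  "matroid_closure M X = {e \<in> ground M. matroid_rank M (insert e X) = matroid_rank M X}"

definition matroid_flat :: "'e pre_matroid \<Rightarrow> 'e set \<Rightarrow> bool" where
  "matroid_flat M X \<longleftrightarrow> X \<subseteq> ground M \<and> matroid_closure M X = X"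

definition matroid_contract :: "'e pre_matroid \<Rightarrow> 'e set \<Rightarrow> 'e pre_matroid" where
  "matroid_contract M X =
     \<lparr>ground = ground M - X,
      indep = (\<lambda>I. I \<subseteq> ground M - X \<and> (\<exists>J. matroid_basis_of M X J \<and> indep M (I \<union> J)))\<rparr>"

text \<open>No loops and no parallel pairs.\<close>

definition simple_matroid :: "'e pre_matroid \<Rightarrow> bool" where
  "simple_matroid M \<longleftrightarrow>
     \<not> (\<exists>e. matroid_circuit M {e}) \<and> \<not> (\<exists>e f. e \<noteq> f \<and> matroid_circuit M {e, f})"

text \<open>The matroid on the empty ground set is connected; so the contraction of the whole ground
  set, which is always a flat, never prevents a matroid from being unbreakable.\<close>

definition connected_matroid :: "'e pre_matroid \<Rightarrow> bool" where
  "connected_matroid M \<longleftrightarrow>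
     (\<forall>e \<in> ground M. \<forall>f \<in> ground M. e \<noteq> f \<longrightarrow> (\<exists>C. matroid_circuit M C \<and> e \<in> C \<and> f \<in> C))"

text \<open>Tutte's \<open>k\<close>-separations: the condition on ranks is \<open>r(X) + r(E - X) - r(E) \<le> k - 1\<close>.\<close>

definition matroid_separation :: "'e pre_matroid \<Rightarrow> nat \<Rightarrow> 'e set \<Rightarrow> bool" where
  "matroid_separation M k X \<longleftrightarrow>
     X \<subseteq> ground M \<and> k \<le> card X \<and> k \<le> card (ground M - X) \<and>
     matroid_rank M X + matroid_rank M (ground M - X) < matroid_rank M (ground M) + k"

definition n_connected_matroid :: "nat \<Rightarrow> 'e pre_matroid \<Rightarrow> bool" where
  "n_connected_matroid n M \<longleftrightarrow> (\<forall>k. 1 \<le> k \<and> k < n \<longrightarrow> \<not> (\<exists>X. matroid_separation M k X))"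

definition unbreakable_matroid :: "'e pre_matroid \<Rightarrow> bool" where
  "unbreakable_matroid M \<longleftrightarrow>
     connected_matroid M \<and>
     (\<forall>X. matroid_flat M X \<longrightarrow> connected_matroid (matroid_contract M X))"


section \<open>The matroid of a quasi-biased graph\<close>

definition quasi_biased_circuit ::
  "('v, 'e) multigraph \<Rightarrow> 'e set set \<Rightarrow> 'e set set \<Rightarrow> 'e set set \<Rightarrow> 'e set \<Rightarrow> bool" where
  "quasi_biased_circuit G \<B> \<L> \<F> X \<longleftrightarrow>
     X \<in> \<B> \<or>
     (is_theta G X \<and> \<not> (\<exists>C \<in> \<B>. C \<subseteq> X)) \<or>
     (\<exists>C1 C2. is_tight_handcuff G C1 C2 X \<and> C1 \<notin> \<B> \<and> C2 \<notin> \<B>) \<or>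
     (\<exists>C1 \<in> \<L>. \<exists>C2 \<in> \<L>. vertex_disjoint G C1 C2 \<and> X = C1 \<union> C2) \<or>
     (\<exists>C1 \<in> \<F>. \<exists>C2 \<in> \<F>. is_loose_handcuff G C1 C2 X)"

text \<open>\<open>M\<close> is the matroid on \<open>edges G\<close> whose circuits are the sets above. The following
  lemma shows that these conditions determine \<open>M\<close>.\<close>

definition is_quasi_biased_matroid ::
  "('v, 'e) multigraph \<Rightarrow> 'e set set \<Rightarrow> 'e set set \<Rightarrow> 'e set set \<Rightarrow> 'e pre_matroid \<Rightarrow> bool" where
  "is_quasi_biased_matroid G \<B> \<L> \<F> M \<longleftrightarrow>
     matroid M \<and> ground M = edges G \<and>
     (\<forall>X. matroid_circuit M X \<longleftrightarrow> quasi_biased_circuit G \<B> \<L> \<F> X)"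

lemma (in matroid) indep_iff_no_circuit:
  "indep M I \<longleftrightarrow> I \<subseteq> ground M \<and> \<not> (\<exists>C. matroid_circuit M C \<and> C \<subseteq> I)"
proof
  assume "indep M I"
  then show "I \<subseteq> ground M \<and> \<not> (\<exists>C. matroid_circuit M C \<and> C \<subseteq> I)"
    using indep_subset_ground indep_subset[of I] by (auto simp: matroid_circuit_def)
next
  assume I: "I \<subseteq> ground M \<and> \<not> (\<exists>C. matroid_circuit M C \<and> C \<subseteq> I)"
  show "indep M I"
  proof (rule ccontr)
    assume dep: "\<not> indep M I"
    have fin: "finite I" using I finite_ground finite_subset by auto
    obtain C where C: "C \<subseteq> I" "\<not> indep M C"
      and least: "\<And>D. D \<subseteq> I \<and> \<not> indep M D \<Longrightarrow> card C \<le> card D"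
      using ex_has_least_nat[of "\<lambda>X. X \<subseteq> I \<and> \<not> indep M X" I card] dep by auto
    have min: "indep M D" if "D \<subset> C" for D
    proof (rule ccontr)
      assume "\<not> indep M D"
      then have "card C \<le> card D" using least[of D] that C(1) by auto
      moreover have "card D < card C" using psubset_card_mono that C(1) fin finite_subset by metis
      ultimately show False by simp
    qed
    have "C \<subseteq> ground M" using subset_trans[OF C(1)] I by simp
    then have "matroid_circuit M C" using C(2) min by (simp add: matroid_circuit_def)
    then show False using I C(1) by simp
  qed
qed

lemma is_quasi_biased_matroid_unique:
  assumes "is_quasi_biased_matroid G \<B> \<L> \<F> M" and "is_quasi_biased_matroid G \<B> \<L> \<F> N"
  shows "M = N"
proof -
  have "indep M I = indep N I" for I
    using assms matroid.indep_iff_no_circuit[of M I] matroid.indep_iff_no_circuit[of N I]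
    unfolding is_quasi_biased_matroid_def by simp
  then have "indep M = indep N" by blast
  then show ?thesis using assms unfolding is_quasi_biased_matroid_def by simp
qed

end

theory Submission
  imports Defs
begin

text \<open>Suppose that \<open>M\<close> is unbreakable, with a 2-separation \<open>(X, Y)\<close>. Contracting the closure of
  \<open>C \<inter> X\<close> for a circuit \<open>C\<close> that meets both sides shows that \<open>C \<inter> X\<close> spans \<open>X\<close>; so every such
  crossing circuit has \<open>r(M) + 1\<close> elements, contains a basis of each side, and passes through all vertices.
  As \<open>r(M)\<close> is at least the number of vertices, neither a cycle of \<open>\<B>\<close> nor the union of two
  disjoint cycles of \<open>\<L>\<close> can cross, and we may take \<open>L\<^sub>1, L\<^sub>2 \<in> \<L>\<close> disjoint with both inside \<open>X\<close>.

  If \<open>D\<close> is a crossing cycle and \<open>Z \<subseteq> X\<close> a cycle outside \<open>\<B>\<close> meeting \<open>D\<close>, then \<open>Z\<close> together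
  with an arc of \<open>D\<close> (or all of \<open>D\<close>) is a crossing theta or tight handcuff, which covers all vertices.
  Applied to \<open>L\<^sub>1\<close> and \<open>L\<^sub>2\<close>, this makes \<open>D\<close> Hamiltonian, and then \<open>Z\<close> occupies an
  interval of the path that remains of \<open>D\<close> after deleting an edge of \<open>Y\<close>. Let \<open>F\<^sub>1, F\<^sub>2 \<in> \<F>\<close> be disjoint; they cannot cross.
  If both lie in \<open>X\<close>, then \<open>L\<^sub>1, L\<^sub>2, F\<^sub>1, F\<^sub>2\<close> are intervals whose
  intersection graph is a 4-cycle, which is impossible. If one lies in \<open>Y\<close>, a crossing cycle
  made of arcs of these four cycles contains too few edges of \<open>Y\<close> to span \<open>Y\<close>,
  since \<open>F\<^sub>1 \<union> F\<^sub>2\<close> is independent.\<close>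

section \<open>Rank, closure and contraction\<close>

lemma circuit_Int_indep:
  assumes "matroid_circuit M C" "x \<in> C" "x \<notin> S"
  shows "indep M (C \<inter> S)"
proof -
  have "C \<inter> S \<subset> C" using assms(2,3) by auto
  then show ?thesis using assms(1) unfolding matroid_circuit_def by simp
qed

context matroid
begin

lemma finite_indep: "indep M I \<Longrightarrow> finite I"
  using indep_subset_ground finite_ground finite_subset by blast

lemma finite_indep_cards: "finite {card I | I. I \<subseteq> X \<and> indep M I}"
proof -
  have "{card I | I. I \<subseteq> X \<and> indep M I} \<subseteq> card ` Pow (ground M)"
    using indep_subset_ground by auto
  then show ?thesis using finite_ground by (meson finite_Pow_iff finite_imageI finite_subset)
qed

lemma card_le_rank: "indep M I \<Longrightarrow> I \<subseteq> X \<Longrightarrow> card I \<le> matroid_rank M X"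
  unfolding matroid_rank_def using finite_indep_cards by (intro Max_ge) auto

lemma rank_attained: "\<exists>I. I \<subseteq> X \<and> indep M I \<and> card I = matroid_rank M X"
proof -
  have "matroid_rank M X \<in> {card I | I. I \<subseteq> X \<and> indep M I}"
    unfolding matroid_rank_def using finite_indep_cards indep_empty by (intro Max_in) auto
  then show ?thesis by auto
qed

lemma rank_mono: "X \<subseteq> Y \<Longrightarrow> matroid_rank M X \<le> matroid_rank M Y"
  using rank_attained[of X] card_le_rank[of _ Y] by fastforce

lemma rank_le_card: "finite X \<Longrightarrow> matroid_rank M X \<le> card X"
  using rank_attained[of X] card_mono by metis

lemma rank_indep: "indep M I \<Longrightarrow> matroid_rank M I = card I"
  using card_le_rank[of I I] rank_le_card[of I] finite_indep by fastforce

lemma indep_if_rank: "finite I \<Longrightarrow> card I \<le> matroid_rank M I \<Longrightarrow> indep M I"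
  using rank_attained[of I] by (metis card_seteq)

lemma indep_extend:
  assumes "indep M I" "I \<subseteq> X"
  shows "\<exists>J. I \<subseteq> J \<and> J \<subseteq> X \<and> indep M J \<and> card J = matroid_rank M X"
  using assms
proof (induction "matroid_rank M X - card I" arbitrary: I)
  case 0
  then show ?case using card_le_rank[of I X] by auto
next
  case (Suc n)
  obtain K where K: "K \<subseteq> X" "indep M K" "card K = matroid_rank M X" using rank_attained by blast
  with Suc have "card I < card K" by linarith
  then obtain e where e: "e \<in> K - I" "indep M (insert e I)" using indep_augment[OF Suc.prems(1) K(2)] by blast
  have "card (insert e I) = Suc (card I)" using e finite_indep[OF Suc.prems(1)] by auto
  then have "\<exists>J. insert e I \<subseteq> J \<and> J \<subseteq> X \<and> indep M J \<and> card J = matroid_rank M X"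
    using Suc e K by (intro Suc.hyps(1)) auto
  then show ?case by blast
qed

text \<open>A basis \<open>I\<close> of the intersection is extended to a basis \<open>J\<close> of
  the union; the traces of \<open>J\<close> on \<open>A\<close> and \<open>B\<close> are
  independent, and their common part contains \<open>I\<close>.\<close>

lemma rank_submodular:
  "matroid_rank M (A \<union> B) + matroid_rank M (A \<inter> B) \<le> matroid_rank M A + matroid_rank M B"
proof -
  obtain I where I: "I \<subseteq> A \<inter> B" "indep M I" "card I = matroid_rank M (A \<inter> B)"
    using rank_attained by blast
  obtain J where J: "I \<subseteq> J" "J \<subseteq> A \<union> B" "indep M J" "card J = matroid_rank M (A \<union> B)"
    using indep_extend[of I "A \<union> B"] I by blast
  have fin: "finite J" using J finite_indep by blast
  have "card (J \<inter> A) \<le> matroid_rank M A" "card (J \<inter> B) \<le> matroid_rank M B"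
    using J indep_subset[of J] by (auto intro!: card_le_rank)
  moreover have "card (J \<inter> A) + card (J \<inter> B) = card J + card (J \<inter> A \<inter> B)"
  proof -
    have "(J \<inter> A) \<union> (J \<inter> B) = J" "(J \<inter> A) \<inter> (J \<inter> B) = J \<inter> A \<inter> B" using J(2) by auto
    then show ?thesis using card_Un_Int[of "J \<inter> A" "J \<inter> B"] fin by simp
  qed
  moreover have "card I \<le> card (J \<inter> A \<inter> B)" using I J fin by (intro card_mono) auto
  ultimately show ?thesis using I J by linarith
qed

lemma rank_circuit:
  assumes "matroid_circuit M C"
  shows "Suc (matroid_rank M C) = card C"
proof -
  have dep: "\<not> indep M C" and C: "C \<subseteq> ground M" "finite C"
    using assms finite_ground finite_subset unfolding matroid_circuit_def by auto
  then obtain c where c: "c \<in> C" using indep_empty by fastforce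
  have "indep M (C - {c})" using assms c unfolding matroid_circuit_def by blast
  then have "card (C - {c}) \<le> matroid_rank M C" by (intro card_le_rank) auto
  moreover have "\<not> card C \<le> matroid_rank M C" using dep C indep_if_rank by blast
  ultimately show ?thesis using c C by simp
qed

text \<open>By submodularity an element adds no more rank to \<open>A \<union> B\<close> than to
  \<open>B\<close>, so elements that are absorbed one at a time are absorbed together.\<close>

lemma rank_absorb:
  assumes "finite A" "\<And>e. e \<in> A \<Longrightarrow> matroid_rank M (insert e B) = matroid_rank M B"
  shows "matroid_rank M (A \<union> B) = matroid_rank M B"
  using assms
proof (induction A)
  case (insert e A)
  have "matroid_rank M ((A \<union> B) \<union> insert e B) + matroid_rank M ((A \<union> B) \<inter> insert e B)
      \<le> matroid_rank M (A \<union> B) + matroid_rank M (insert e B)" by (rule rank_submodular)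
  moreover have "matroid_rank M B \<le> matroid_rank M ((A \<union> B) \<inter> insert e B)"
    by (rule rank_mono) auto
  moreover have "(A \<union> B) \<union> insert e B = insert e A \<union> B" by auto
  moreover have "matroid_rank M B \<le> matroid_rank M (insert e A \<union> B)" by (rule rank_mono) auto
  ultimately show ?case using insert by simp
qed simp

lemma closure_subset_ground: "matroid_closure M A \<subseteq> ground M"
  unfolding matroid_closure_def by auto

lemma subset_closure: "A \<subseteq> ground M \<Longrightarrow> A \<subseteq> matroid_closure M A"
  unfolding matroid_closure_def by (auto simp: insert_absorb)

lemma rank_closure:
  assumes "A \<subseteq> ground M"
  shows "matroid_rank M (matroid_closure M A) = matroid_rank M A"
proof -
  have "finite (matroid_closure M A)"
    using closure_subset_ground finite_ground finite_subset by blast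
  then have "matroid_rank M (matroid_closure M A \<union> A) = matroid_rank M A"
    by (rule rank_absorb) (auto simp: matroid_closure_def)
  then show ?thesis using subset_closure[OF assms] by (simp add: Un_absorb2)
qed

lemma flat_closure:
  assumes "A \<subseteq> ground M"
  shows "matroid_flat M (matroid_closure M A)"
proof -
  have "e \<in> matroid_closure M A" if "e \<in> matroid_closure M (matroid_closure M A)" for e
  proof -
    have "matroid_rank M (insert e A) \<le> matroid_rank M (insert e (matroid_closure M A))"
      using subset_closure[OF assms] by (intro rank_mono) auto
    also have "\<dots> = matroid_rank M A" using that rank_closure[OF assms]
      unfolding matroid_closure_def[of M "matroid_closure M A"] by simp
    finally have "matroid_rank M (insert e A) = matroid_rank M A"
      using rank_mono[OF subset_insertI[of A e]] by simp
    then show ?thesis using that unfolding matroid_closure_def by simp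
  qed
  then show ?thesis
    using closure_subset_ground subset_closure[OF closure_subset_ground, of A]
    unfolding matroid_flat_def by blast
qed

lemma card_basis_of: "matroid_basis_of M X I \<Longrightarrow> card I = matroid_rank M X"
  unfolding matroid_basis_of_def using indep_extend by metis

lemma basis_ofI:
  assumes "indep M J" "J \<subseteq> X" "matroid_rank M X \<le> card J"
  shows "matroid_basis_of M X J"
  unfolding matroid_basis_of_def
proof (intro conjI allI impI)
  fix K assume K: "J \<subseteq> K \<and> K \<subseteq> X \<and> indep M K"
  then have "card K \<le> card J" using card_le_rank[of K X] assms by linarith
  then show "K = J" using K finite_indep card_seteq by blast
qed (use assms in auto)

text \<open>\<open>matroid_contract\<close> asks for some basis of \<open>X\<close>; here any given
  basis \<open>J\<close> serves. By submodularity \<open>I \<union> J\<close> has the rank of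
  \<open>I \<union> X\<close>, which is at least the size of \<open>I \<union> K\<close>, and
  \<open>J\<close> and \<open>K\<close> are equally large.\<close>

lemma indep_contract_iff:
  assumes J: "matroid_basis_of M X J" and I: "I \<subseteq> ground M - X"
  shows "indep (matroid_contract M X) I \<longleftrightarrow> indep M (I \<union> J)"
proof
  assume "indep (matroid_contract M X) I"
  then obtain K where K: "matroid_basis_of M X K" "indep M (I \<union> K)"
    unfolding matroid_contract_def by auto
  have fin: "finite I" "finite J" "finite K"
    using finite_subset[OF I] finite_ground J K(1) unfolding matroid_basis_of_def
    by (auto dest: finite_indep)
  have sub: "J \<subseteq> X" "K \<subseteq> X" using J K unfolding matroid_basis_of_def by auto
  have "card (I \<union> J) = card I + card J" "card (I \<union> K) = card I + card K"
    using fin sub I by (auto intro!: card_Un_disjoint)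
  moreover have "card J = matroid_rank M X" "card K = matroid_rank M X"
    using card_basis_of J K by auto
  moreover have "card (I \<union> K) \<le> matroid_rank M (I \<union> X)"
    using K sub by (intro card_le_rank) auto
  moreover have "matroid_rank M ((I \<union> J) \<union> X) + matroid_rank M ((I \<union> J) \<inter> X)
      \<le> matroid_rank M (I \<union> J) + matroid_rank M X" by (rule rank_submodular)
  moreover have "(I \<union> J) \<union> X = I \<union> X" "(I \<union> J) \<inter> X = J" using sub I by auto
  moreover have "matroid_rank M J = card J"
    using rank_indep J unfolding matroid_basis_of_def by auto
  ultimately show "indep M (I \<union> J)" using fin by (intro indep_if_rank) auto
next
  assume "indep M (I \<union> J)"
  then show "indep (matroid_contract M X) I"
    using J I unfolding matroid_contract_def by auto
qed

lemma simple_indep_pair: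
  assumes "simple_matroid M" "e \<in> ground M" "f \<in> ground M"
  shows "indep M {e, f}"
proof (rule ccontr)
  assume "\<not> indep M {e, f}"
  then obtain C where C: "matroid_circuit M C" "C \<subseteq> {e, f}"
    using indep_iff_no_circuit assms by auto
  have "C \<noteq> {}" using C indep_empty unfolding matroid_circuit_def by auto
  then have "C = {e} \<or> C = {f} \<or> C = {e, f}" using C by auto
  then show False using assms(1) C(1) unfolding simple_matroid_def by (metis insert_absorb2)
qed

lemma exists_circuit_insert:
  assumes "indep M I" "e \<in> ground M" "\<not> indep M (insert e I)"
  shows "\<exists>C. matroid_circuit M C \<and> e \<in> C \<and> C \<subseteq> insert e I"
proof -
  obtain C where C: "matroid_circuit M C" "C \<subseteq> insert e I"
    using assms indep_iff_no_circuit[of "insert e I"] indep_subset_ground by auto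
  then have "e \<in> C" using assms(1) indep_iff_no_circuit[of I] by blast
  then show ?thesis using C by blast
qed

end

section \<open>Separations of connected and of unbreakable matroids\<close>

lemma matroid_separation_compl:
  "matroid_separation M k X \<Longrightarrow> matroid_separation M k (ground M - X)"
  unfolding matroid_separation_def by (auto simp: double_diff add.commute)

text \<open>With \<open>J = C \<inter> X\<close>, the contraction of the flat spanned by \<open>J\<close> is the direct sum of its
  restrictions to \<open>X\<close> and to its complement, so one of these restrictions is empty.\<close>

lemma (in matroid) crossing_circuit_spans_side:
  assumes ub: "unbreakable_matroid M" and sim: "simple_matroid M"
    and sep: "matroid_separation M 2 X"
    and C: "matroid_circuit M C" and CX: "C \<inter> X \<noteq> {}" and CnX: "C - X \<noteq> {}"
  shows "card (C \<inter> X) = matroid_rank M X"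
proof -
  define Y where "Y = ground M - X"
  define J where "J = C \<inter> X"
  define F where "F = matroid_closure M J"
  have E: "X \<union> Y = ground M" "X \<inter> Y = {}" and cardY: "2 \<le> card Y"
    and rk: "matroid_rank M X + matroid_rank M Y < matroid_rank M (ground M) + 2"
    using sep unfolding matroid_separation_def Y_def by auto
  have Cg: "C \<subseteq> ground M" using C unfolding matroid_circuit_def by auto
  have fin: "finite S" if "S \<subseteq> ground M" for S by (rule finite_subset[OF that finite_ground])
  have finC: "finite C" using fin Cg by blast
  have CC: "C = J \<union> (C \<inter> Y)" "J \<inter> (C \<inter> Y) = {}" using Cg E unfolding J_def by auto
  have iJ: "indep M J" and iCY: "indep M (C \<inter> Y)"
    using CX CnX circuit_Int_indep[OF C, of _ X] circuit_Int_indep[OF C, of _ Y]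
    unfolding J_def Y_def by blast+
  \<comment> \<open>The rank of a circuit is one less than its size, so \<open>J\<close> adds at
    most \<open>card J - 1\<close> to the rank of \<open>Y\<close>. This will cancel the one unit of
    slack that a 2-separation allows.\<close>
  have "matroid_rank M (Y \<union> C) + matroid_rank M (Y \<inter> C) \<le> matroid_rank M Y + matroid_rank M C"
    by (rule rank_submodular)
  moreover have "Y \<union> C = Y \<union> J" using CC by auto
  moreover have "card C = card J + card (C \<inter> Y)"
    using CC finC by (metis card_Un_disjoint finite_Un)
  ultimately have YJ: "matroid_rank M (Y \<union> J) + 1 \<le> matroid_rank M Y + card J"
    using rank_circuit[OF C] rank_indep[OF iCY] by (simp add: inf_commute)
  have Jg: "J \<subseteq> ground M" "J \<subseteq> X" using Cg unfolding J_def by auto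
  have F: "matroid_rank M F = card J" "J \<subseteq> F" "matroid_flat M F"
    unfolding F_def using rank_closure Jg rank_indep[OF iJ] subset_closure flat_closure by auto
  have basis: "matroid_basis_of M F J" using iJ F by (intro basis_ofI) auto
  have "\<not> Y \<subseteq> F"
  proof
    \<comment> \<open>Then \<open>X\<close> spans the whole ground set, so \<open>Y\<close> has rank
      at most 1; but \<open>Y\<close> has two elements and \<open>M\<close> is simple.\<close>
    assume YF: "Y \<subseteq> F"
    have "matroid_rank M (insert y X) = matroid_rank M X" if "y \<in> Y" for y
    proof -
      have "matroid_rank M (insert y J \<union> X) + matroid_rank M (insert y J \<inter> X)
          \<le> matroid_rank M (insert y J) + matroid_rank M X" by (rule rank_submodular)
      moreover have "matroid_rank M (insert y J \<union> X) = matroid_rank M (insert y X)"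
        using Jg by (intro arg_cong[of _ _ "matroid_rank M"]) auto
      moreover have "matroid_rank M J \<le> matroid_rank M (insert y J \<inter> X)"
        using Jg by (intro rank_mono) auto
      moreover have "matroid_rank M (insert y J) = matroid_rank M J"
        using that YF unfolding F_def matroid_closure_def by auto
      moreover have "matroid_rank M X \<le> matroid_rank M (insert y X)" by (rule rank_mono) auto
      ultimately show ?thesis by linarith
    qed
    then have "matroid_rank M (Y \<union> X) = matroid_rank M X"
      using fin[of Y] E by (intro rank_absorb) auto
    then have "matroid_rank M Y < 2" using rk E by (simp add: Un_commute)
    moreover obtain y z where yz: "y \<in> Y" "z \<in> Y" "y \<noteq> z"
      using cardY by (auto simp: numeral_2_eq_2 card_le_Suc_iff)
    moreover have "card {y, z} \<le> matroid_rank M Y"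
      using yz E by (intro card_le_rank simple_indep_pair[OF sim]) auto
    ultimately show False by auto
  qed
  then obtain y where y: "y \<in> Y" "y \<notin> F" by blast
  have "X \<subseteq> F"
  proof
    fix x assume x: "x \<in> X"
    show "x \<in> F"
    proof (rule ccontr)
      assume xF: "x \<notin> F"
      have "connected_matroid (matroid_contract M F)"
        using ub F unfolding unbreakable_matroid_def by blast
      moreover have "x \<in> ground (matroid_contract M F)" "y \<in> ground (matroid_contract M F)" "x \<noteq> y"
        using x y xF E unfolding matroid_contract_def by auto
      \<comment> \<open>The aim is that \<open>K \<union> J\<close> is independent in
        \<open>M\<close>, which contradicts that \<open>K\<close> is a circuit of the
        contraction.\<close>
      ultimately obtain K where K: "matroid_circuit (matroid_contract M F) K" "x \<in> K" "y \<in> K"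
        unfolding connected_matroid_def by blast
      have Kg: "K \<subseteq> ground M - F" using K unfolding matroid_circuit_def matroid_contract_def by auto
      have "indep (matroid_contract M F) (K \<inter> X)" "indep (matroid_contract M F) (K \<inter> Y)"
        using x y E circuit_Int_indep[OF K(1,3), of X] circuit_Int_indep[OF K(1,2), of Y] by blast+
      then have "indep M (K \<inter> X \<union> J)" "indep M (K \<inter> Y \<union> J)"
        using indep_contract_iff[OF basis, of "K \<inter> X"] indep_contract_iff[OF basis, of "K \<inter> Y"] Kg by auto
      then have "matroid_rank M (K \<inter> X \<union> J) = card (K \<inter> X \<union> J)" "matroid_rank M (K \<inter> Y \<union> J) = card (K \<inter> Y \<union> J)"
        by (auto simp: rank_indep)
      moreover have "card (K \<inter> X \<union> J) = card (K \<inter> X) + card J" "card (K \<inter> Y \<union> J) = card (K \<inter> Y) + card J"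
        using Kg F Jg fin[of K] fin[of J] by (auto intro!: card_Un_disjoint)
      ultimately have rX: "matroid_rank M (K \<inter> X \<union> J) = card (K \<inter> X) + card J"
        and rY: "matroid_rank M (K \<inter> Y \<union> J) = card (K \<inter> Y) + card J" by auto
      \<comment> \<open>Over \<open>X\<close>, the set \<open>K \<inter> Y\<close> keeps its full
        size as rank: the loss of 1 in \<open>YJ\<close> balances the excess of 1 allowed by
        \<open>rk\<close>.\<close>
      have "matroid_rank M ((X \<union> K \<inter> Y) \<union> (Y \<union> J)) + matroid_rank M ((X \<union> K \<inter> Y) \<inter> (Y \<union> J))
          \<le> matroid_rank M (X \<union> K \<inter> Y) + matroid_rank M (Y \<union> J)" by (rule rank_submodular)
      moreover have "(X \<union> K \<inter> Y) \<union> (Y \<union> J) = ground M" "(X \<union> K \<inter> Y) \<inter> (Y \<union> J) = K \<inter> Y \<union> J"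
        using E Jg by auto
      ultimately have 1: "matroid_rank M X + card (K \<inter> Y) \<le> matroid_rank M (X \<union> K \<inter> Y)"
        using rY YJ rk by simp
      \<comment> \<open>Submodularity with \<open>X\<close> transfers this to
        \<open>K \<union> J\<close>, whose trace on \<open>X\<close> is the independent set
        \<open>K \<inter> X \<union> J\<close>.\<close>
      have "matroid_rank M ((K \<union> J) \<union> X) + matroid_rank M ((K \<union> J) \<inter> X)
          \<le> matroid_rank M (K \<union> J) + matroid_rank M X" by (rule rank_submodular)
      moreover have "(K \<union> J) \<union> X = X \<union> K \<inter> Y" "(K \<union> J) \<inter> X = K \<inter> X \<union> J"
        using Kg E Jg by auto
      ultimately have "card (K \<inter> Y) + card (K \<inter> X) + card J \<le> matroid_rank M (K \<union> J)"
        using 1 rX by simp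
      moreover have "card (K \<inter> Y) + card (K \<inter> X) = card K"
      proof -
        have "card ((K \<inter> Y) \<union> (K \<inter> X)) = card (K \<inter> Y) + card (K \<inter> X)"
          using E fin[of K] Kg by (intro card_Un_disjoint) auto
        moreover have "(K \<inter> Y) \<union> (K \<inter> X) = K" using Kg E by auto
        ultimately show ?thesis by simp
      qed
      moreover have "card (K \<union> J) = card K + card J"
        using Kg F Jg fin[of K] fin[of J] by (intro card_Un_disjoint) auto
      ultimately have "indep M (K \<union> J)" using fin[of "K \<union> J"] Kg Jg by (intro indep_if_rank) auto
      then have "indep (matroid_contract M F) K" using indep_contract_iff[OF basis Kg] by simp
      then show False using K(1) unfolding matroid_circuit_def by simp
    qed
  qed
  then have "matroid_rank M X \<le> card J" using rank_mono[of X F] F(1) by simp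
  moreover have "card J \<le> matroid_rank M X" by (rule card_le_rank[OF iJ Jg(2)])
  ultimately show ?thesis unfolding J_def by simp
qed

text \<open>A circuit \<open>C\<close> meeting both sides has independent traces, whose ranks add up
  to one more than the rank of \<open>C\<close>. Two applications of submodularity pass this excess
  on to the sides themselves.\<close>

lemma (in matroid) connected_no_1_separation:
  assumes "connected_matroid M"
  shows "\<not> matroid_separation M 1 X"
proof
  assume sep: "matroid_separation M 1 X"
  define Y where "Y = ground M - X"
  have XY: "X \<subseteq> ground M" "1 \<le> card X" "1 \<le> card Y"
    "matroid_rank M X + matroid_rank M Y \<le> matroid_rank M (ground M)"
    using sep unfolding matroid_separation_def Y_def by auto
  then obtain x y where xy: "x \<in> X" "y \<in> Y"
    by (metis One_nat_def card.empty ex_in_conv not_less_eq_eq zero_le)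
  then obtain C where C: "matroid_circuit M C" "x \<in> C" "y \<in> C"
    using assms XY unfolding connected_matroid_def Y_def by (metis DiffD1 DiffD2 subsetD)
  have Cg: "C \<subseteq> ground M" using C(1) unfolding matroid_circuit_def by simp
  have finC: "finite C" by (rule finite_subset[OF Cg finite_ground])
  have "indep M (C \<inter> X)" "indep M (C \<inter> Y)"
    using xy circuit_Int_indep[OF C(1,3), of X] circuit_Int_indep[OF C(1,2), of Y]
    unfolding Y_def by blast+
  then have r: "matroid_rank M (C \<inter> X) = card (C \<inter> X)" "matroid_rank M (C \<inter> Y) = card (C \<inter> Y)"
    by (auto simp: rank_indep)
  have "card ((C \<inter> X) \<union> (C \<inter> Y)) = card (C \<inter> X) + card (C \<inter> Y)"
    using finC unfolding Y_def by (intro card_Un_disjoint) auto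
  moreover have "(C \<inter> X) \<union> (C \<inter> Y) = C" using Cg unfolding Y_def by auto
  ultimately have c: "card C = card (C \<inter> X) + card (C \<inter> Y)" by simp
  have "matroid_rank M (Y \<union> C) + matroid_rank M (Y \<inter> C) \<le> matroid_rank M Y + matroid_rank M C"
    by (rule rank_submodular)
  moreover have "matroid_rank M (X \<union> (Y \<union> C)) + matroid_rank M (X \<inter> (Y \<union> C))
      \<le> matroid_rank M X + matroid_rank M (Y \<union> C)" by (rule rank_submodular)
  moreover have "X \<union> (Y \<union> C) = ground M" "X \<inter> (Y \<union> C) = C \<inter> X" "Y \<inter> C = C \<inter> Y"
    using Cg XY unfolding Y_def by auto
  ultimately show False using rank_circuit[OF C(1)] r c XY by simp
qed

lemma (in matroid) not_3_connectedE:
  assumes "connected_matroid M" "\<not> n_connected_matroid 3 M"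
  obtains X where "matroid_separation M 2 X"
proof -
  obtain k X where k: "1 \<le> k" "k < 3" "matroid_separation M k X"
    using assms(2) unfolding n_connected_matroid_def by blast
  have "k \<noteq> 1" using k(3) connected_no_1_separation[OF assms(1)] by metis
  then have "k = 2" using k(1,2) by linarith
  then show ?thesis using k(3) that by metis
qed

section \<open>Paths and cycles\<close>

lemma vertex_set_Un: "vertex_set G (S \<union> T) = vertex_set G S \<union> vertex_set G T"
  unfolding vertex_set_def by auto

lemma vertex_set_mono: "S \<subseteq> T \<Longrightarrow> vertex_set G S \<subseteq> vertex_set G T"
  unfolding vertex_set_def by auto

lemma ends_subset_vertex_set: "e \<in> S \<Longrightarrow> ends G e \<subseteq> vertex_set G S"
  unfolding vertex_set_def by auto

lemma path_lengths: "is_path G vs es \<Longrightarrow> length vs = Suc (length es)"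
  unfolding is_path_def by simp

lemma path_ends_nth: "is_path G vs es \<Longrightarrow> i < length es \<Longrightarrow> ends G (es ! i) = {vs ! i, vs ! Suc i}"
  unfolding is_path_def by simp

lemma path_nth_eq_iff:
  "is_path G vs es \<Longrightarrow> i \<le> length es \<Longrightarrow> j \<le> length es \<Longrightarrow> vs ! i = vs ! j \<longleftrightarrow> i = j"
  unfolding is_path_def by (auto simp: nth_eq_iff_index_eq)

lemma path_hd: "is_path G vs es \<Longrightarrow> hd vs = vs ! 0"
  using path_lengths[of G vs es] by (metis hd_conv_nth length_0_conv nat.distinct(1))

lemma path_last: "is_path G vs es \<Longrightarrow> last vs = vs ! length es"
  using path_lengths[of G vs es] by (metis diff_Suc_1 last_conv_nth length_0_conv nat.distinct(1))

lemma path_set: "is_path G vs es \<Longrightarrow> set vs = (!) vs ` {..length es}"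
  using path_lengths[of G vs es] by (auto simp: in_set_conv_nth image_iff less_Suc_eq_le)

lemma path_hd_in: "is_path G vs es \<Longrightarrow> hd vs \<in> set vs"
  using path_lengths[of G vs es] by (cases vs) auto

lemma path_last_in: "is_path G vs es \<Longrightarrow> last vs \<in> set vs"
  using path_lengths[of G vs es] by (cases vs) auto

lemma path_edges: "is_path G vs es \<Longrightarrow> set es \<subseteq> edges G"
  unfolding is_path_def by simp

lemma path_hd_eq_last: "is_path G vs es \<Longrightarrow> hd vs = last vs \<longleftrightarrow> es = []"
  using path_nth_eq_iff[of G vs es 0 "length es"] by (simp add: path_hd path_last)

lemma path_ends_in_set: "is_path G vs es \<Longrightarrow> e \<in> set es \<Longrightarrow> ends G e \<subseteq> set vs"
  by (auto simp: in_set_conv_nth path_ends_nth path_set)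

lemma path_edge_card: "is_path G vs es \<Longrightarrow> e \<in> set es \<Longrightarrow> card (ends G e) = 2"
  by (auto simp: in_set_conv_nth path_ends_nth path_nth_eq_iff)

lemma path_edge_at:
  assumes "is_path G vs es" "e \<in> set es" "vs ! k \<in> ends G e" "k \<le> length es"
  shows "(k < length es \<and> e = es ! k) \<or> (0 < k \<and> e = es ! (k - 1))"
proof -
  obtain i where i: "i < length es" "e = es ! i" using assms(2) by (auto simp: in_set_conv_nth)
  then have "vs ! k = vs ! i \<or> vs ! k = vs ! Suc i" using assms path_ends_nth by fastforce
  then have "k = i \<or> k = Suc i" using path_nth_eq_iff[OF assms(1)] assms(4) i by auto
  then show ?thesis using i by auto
qed

text \<open>\<open>is_path\<close> demands distinct vertices only; an edge determines its pair of
  consecutive vertices and thereby its index.\<close>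

lemma path_edges_distinct: assumes "is_path G vs es" shows "distinct es"
proof -
  have "i = j" if ij: "i < length es" "j < length es" "es ! i = es ! j" for i j
  proof -
    have "{vs ! i, vs ! Suc i} = {vs ! j, vs ! Suc j}"
      using path_ends_nth[OF assms] ij by metis
    then have "i = j \<or> i = Suc j \<and> Suc i = j"
      using ij path_nth_eq_iff[OF assms, of i j] path_nth_eq_iff[OF assms, of i "Suc j"]
        path_nth_eq_iff[OF assms, of "Suc i" j] unfolding doubleton_eq_iff by auto
    then show ?thesis by auto
  qed
  then show ?thesis by (auto simp: distinct_conv_nth)
qed

lemma path_vertex_set: "is_path G vs es \<Longrightarrow> es \<noteq> [] \<Longrightarrow> vertex_set G (set es) = set vs"
proof
  assume p: "is_path G vs es" and ne: "es \<noteq> []"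
  show "vertex_set G (set es) \<subseteq> set vs"
    using path_ends_in_set[OF p] unfolding vertex_set_def by blast
  show "set vs \<subseteq> vertex_set G (set es)"
  proof
    fix v assume "v \<in> set vs"
    then obtain i where i: "i \<le> length es" "v = vs ! i" using path_set[OF p] by auto
    show "v \<in> vertex_set G (set es)"
    proof (cases "i < length es")
      case True
      then show ?thesis using i path_ends_nth[OF p True] unfolding vertex_set_def by force
    next
      case False
      then have "i - 1 < length es" "Suc (i - 1) = i" using i ne by (cases es; auto)+
      then show ?thesis using i path_ends_nth[OF p, of "i - 1"] unfolding vertex_set_def
        by (intro UN_I[of "es ! (i - 1)"]) auto
    qed
  qed
qed

section \<open>Segments, reversal and concatenation of paths\<close>

lemma path_singleton: "v \<in> verts G \<Longrightarrow> is_path G [v] []"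
  unfolding is_path_def by simp

lemma path_segment:
  assumes p: "is_path G vs es" and ij: "i \<le> j" "j \<le> length es"
  obtains ws fs where "is_path G ws fs" "hd ws = vs ! i" "last ws = vs ! j"
    "set ws = (!) vs ` {i..j}" "set fs = (!) es ` {i..<j}"
proof -
  define ws fs where "ws = take (Suc j - i) (drop i vs)" and "fs = take (j - i) (drop i es)"
  have len: "length ws = Suc (length fs)" "length fs = j - i"
    using ij path_lengths[OF p] unfolding ws_def fs_def by auto
  have nth: "ws ! k = vs ! (i + k)" if "k \<le> j - i" for k
    using that ij path_lengths[OF p] unfolding ws_def by auto
  have nthe: "fs ! k = es ! (i + k)" if "k < j - i" for k
    using that ij unfolding fs_def by auto
  have "set ws \<subseteq> set vs" "set fs \<subseteq> set es" unfolding ws_def fs_def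
    by (meson order_trans set_drop_subset set_take_subset)+
  moreover have "distinct ws" using p unfolding is_path_def ws_def by simp
  moreover have "ends G (fs ! k) = {ws ! k, ws ! Suc k}" if "k < length fs" for k
    using path_ends_nth[OF p, of "i + k"] that len nth[of k] nth[of "Suc k"] nthe[of k] ij by simp
  ultimately have wp: "is_path G ws fs" using p len unfolding is_path_def by auto
  have "set ws = (!) vs ` {i..j}"
  proof -
    have "set ws = (\<lambda>k. vs ! (i + k)) ` {..j - i}"
      using path_set[OF wp] len nth by auto
    also have "\<dots> = (!) vs ` ((+) i ` {..j - i})" by (simp add: image_image)
    also have "(+) i ` {..j - i} = {i..j}" using ij image_add_atLeastAtMost[of i 0 "j - i"]
      by (simp add: atMost_atLeast0)
    finally show ?thesis .
  qed
  moreover have "set fs = (!) es ` {i..<j}"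
  proof -
    have "set fs = (!) fs ` {0..<j - i}" using len by (auto simp: in_set_conv_nth)
    also have "\<dots> = (\<lambda>k. es ! (i + k)) ` {0..<j - i}" using nthe by auto
    also have "\<dots> = (!) es ` ((+) i ` {0..<j - i})" by (simp only: image_image)
    also have "(+) i ` {0..<j - i} = {i..<j}" using ij image_add_atLeastLessThan[of i 0 "j - i"] by simp
    finally show ?thesis .
  qed
  ultimately show ?thesis using that[OF wp] path_hd[OF wp] path_last[OF wp] nth[of 0] nth[of "j - i"] len ij
    by simp
qed

lemma path_rev:
  assumes p: "is_path G vs es"
  shows "is_path G (rev vs) (rev es)"
proof -
  have "ends G (rev es ! k) = {rev vs ! k, rev vs ! Suc k}" if "k < length es" for k
  proof -
    have "rev es ! k = es ! (length es - Suc k)" using that by (simp add: rev_nth)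
    moreover have "rev vs ! k = vs ! (length es - k)" "rev vs ! Suc k = vs ! (length es - Suc k)"
      using that path_lengths[OF p] by (auto simp: rev_nth)
    moreover have "Suc (length es - Suc k) = length es - k" using that by simp
    ultimately show ?thesis using path_ends_nth[OF p, of "length es - Suc k"] that by auto
  qed
  then show ?thesis using p unfolding is_path_def by auto
qed

lemma path_rev_hd_last: "is_path G vs es \<Longrightarrow> hd (rev vs) = last vs \<and> last (rev vs) = hd vs"
  using path_lengths[of G vs es] by (cases vs) (auto simp: hd_rev last_rev)

lemma path_join:
  assumes p: "is_path G vs es" and q: "is_path G ws fs"
    and disj: "set vs \<inter> set ws = {}" and f: "f \<in> edges G" "ends G f = {last vs, hd ws}"
  shows "is_path G (vs @ ws) (es @ f # fs)" "hd (vs @ ws) = hd vs" "last (vs @ ws) = last ws"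
proof -
  have ne: "vs \<noteq> []" "ws \<noteq> []" using path_lengths[OF p] path_lengths[OF q] by auto
  then show "hd (vs @ ws) = hd vs" "last (vs @ ws) = last ws" by auto
  have "ends G ((es @ f # fs) ! k) = {(vs @ ws) ! k, (vs @ ws) ! Suc k}"
    if k: "k < length (es @ f # fs)" for k
  proof (cases "k < length es")
    case True
    then show ?thesis using path_ends_nth[OF p True] path_lengths[OF p] by (simp add: nth_append)
  next
    case False
    show ?thesis
    proof (cases "k = length es")
      case True
      then show ?thesis
        using f path_last[OF p] path_hd[OF q] path_lengths[OF p] by (simp add: nth_append)
    next
      case False
      with \<open>\<not> k < length es\<close> obtain m where m: "k = Suc (length es + m)"
        by (metis add_Suc_right less_imp_Suc_add linorder_neqE_nat)
      then have "m < length fs" using k by simp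
      then show ?thesis using path_ends_nth[OF q] path_lengths[OF p] m by (simp add: nth_append)
    qed
  qed
  then show "is_path G (vs @ ws) (es @ f # fs)"
    using p q disj f unfolding is_path_def by auto
qed

lemma path_snoc:
  assumes "is_path G vs es" "v \<in> verts G" "v \<notin> set vs" "f \<in> edges G" "ends G f = {last vs, v}"
  shows "is_path G (vs @ [v]) (es @ [f])"
  using path_join(1)[OF assms(1) path_singleton[OF assms(2)], of f] assms by simp

text \<open>The cycle is cut open at a chosen edge \<open>f\<close>, so that its vertices receive
  the linear indices 0 to \<open>length es\<close>. For a loop, \<open>es\<close> is empty.\<close>

definition cycle_rep :: "('v, 'e) multigraph \<Rightarrow> 'e set \<Rightarrow> 'e \<Rightarrow> 'v list \<Rightarrow> 'e list \<Rightarrow> bool" where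
  "cycle_rep G Z f vs es \<longleftrightarrow> is_path G vs es \<and> f \<in> edges G \<and> f \<notin> set es \<and>
     ends G f = {hd vs, last vs} \<and> Z = insert f (set es)"

lemma cycle_repD:
  assumes "cycle_rep G Z f vs es"
  shows "is_path G vs es" "f \<in> edges G" "f \<notin> set es" "ends G f = {hd vs, last vs}"
    "Z = insert f (set es)" "f \<in> Z" "set es \<subseteq> Z"
  using assms unfolding cycle_rep_def by auto

lemma cycle_rep_is_cycle: "cycle_rep G Z f vs es \<Longrightarrow> is_cycle G Z"
  unfolding cycle_rep_def is_cycle_def by blast

text \<open>Rotation: the part of the path behind \<open>f\<close> comes first, then the old closing
  edge \<open>e\<close>, then the part before \<open>f\<close>.\<close>

lemma cycle_rep_at:
  assumes "is_cycle G Z" "f \<in> Z"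
  obtains vs es where "cycle_rep G Z f vs es"
proof -
  obtain vs es e where e: "cycle_rep G Z e vs es"
    using assms(1) unfolding is_cycle_def cycle_rep_def by blast
  note p = cycle_repD(1)[OF e]
  show ?thesis
  proof (cases "f = e")
    case True
    then show ?thesis using e that by blast
  next
    case False
    then obtain k where k: "k < length es" "f = es ! k"
      using assms(2) cycle_repD(5)[OF e] by (auto simp: in_set_conv_nth)
    obtain vs1 es1 where 1: "is_path G vs1 es1" "hd vs1 = vs ! Suc k" "last vs1 = vs ! length es"
      "set vs1 = (!) vs ` {Suc k..length es}" "set es1 = (!) es ` {Suc k..<length es}"
      using path_segment[OF p, of "Suc k" "length es"] k by auto
    obtain vs2 es2 where 2: "is_path G vs2 es2" "hd vs2 = vs ! 0" "last vs2 = vs ! k"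
      "set vs2 = (!) vs ` {0..k}" "set es2 = (!) es ` {0..<k}"
      using path_segment[OF p, of 0 k] k by auto
    have disj: "set vs1 \<inter> set vs2 = {}" using 1(4) 2(4) k path_nth_eq_iff[OF p] by fastforce
    have j: "is_path G (vs1 @ vs2) (es1 @ e # es2)"
      "hd (vs1 @ vs2) = vs ! Suc k" "last (vs1 @ vs2) = vs ! k"
      using path_join[OF 1(1) 2(1) disj, of e] cycle_repD(2,4)[OF e] 1 2 path_hd[OF p] path_last[OF p]
      by (auto simp: insert_commute)
    have idx: "{..<length es} = {Suc k..<length es} \<union> {0..<k} \<union> {k}" using k by auto
    have "set es = (!) es ` {..<length es}" by (auto simp: in_set_conv_nth)
    then have ses: "set es = set es1 \<union> set es2 \<union> {f}" using 1(5) 2(5) k unfolding idx by auto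
    have "f \<notin> set es1" "f \<notin> set es2"
      using 1(5) 2(5) k path_edges_distinct[OF p] by (auto simp: distinct_conv_nth)
    then have "cycle_rep G Z f (vs1 @ vs2) (es1 @ e # es2)"
      using j False k path_ends_nth[OF p k(1)] ses cycle_repD(5)[OF e] path_edges[OF p]
      unfolding cycle_rep_def by (auto simp: insert_commute)
    then show ?thesis by (rule that)
  qed
qed

lemma cycle_rep_exists:
  assumes "is_cycle G Z" obtains f vs es where "cycle_rep G Z f vs es"
  using assms unfolding is_cycle_def cycle_rep_def by blast

lemma cycle_rep_vertex_set: "cycle_rep G Z f vs es \<Longrightarrow> vertex_set G Z = set vs"
proof -
  assume r: "cycle_rep G Z f vs es"
  note p = cycle_repD(1)[OF r]
  have "vertex_set G Z = {hd vs, last vs} \<union> vertex_set G (set es)"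
    using cycle_repD(4,5)[OF r] unfolding vertex_set_def by auto
  also have "\<dots> = set vs"
  proof (cases "es = []")
    case True
    then have "vs = [hd vs]" using path_lengths[OF p] by (cases vs) auto
    then obtain v where "vs = [v]" by blast
    then show ?thesis using True by (simp add: vertex_set_def)
  next
    case False
    then show ?thesis using path_vertex_set[OF p] path_hd_in[OF p] path_last_in[OF p] by auto
  qed
  finally show ?thesis .
qed

lemma cycle_edges: "is_cycle G Z \<Longrightarrow> Z \<subseteq> edges G"
  unfolding is_cycle_def is_path_def by auto

lemma cycle_nonempty: "is_cycle G Z \<Longrightarrow> Z \<noteq> {}"
  unfolding is_cycle_def by auto

lemma cycle_card: "is_cycle G Z \<Longrightarrow> card Z = card (vertex_set G Z)"
proof -
  assume "is_cycle G Z"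
  then obtain f vs es where r: "cycle_rep G Z f vs es" by (rule cycle_rep_exists)
  note p = cycle_repD(1)[OF r]
  have "card Z = Suc (length es)"
    using cycle_repD(3,5)[OF r] distinct_card[OF path_edges_distinct[OF p]] by simp
  moreover have "card (vertex_set G Z) = length vs"
    using cycle_rep_vertex_set[OF r] p distinct_card[of vs] unfolding is_path_def by simp
  ultimately show ?thesis using path_lengths[OF p] by simp
qed

lemma cycle_loop:
  assumes Z: "is_cycle G Z" and e: "e \<in> Z" "card (ends G e) \<noteq> 2"
  shows "Z = {e}"
proof -
  obtain vs es where r: "cycle_rep G Z e vs es" using cycle_rep_at[OF Z e(1)] .
  have "hd vs = last vs" using e(2) unfolding cycle_repD(4)[OF r] by (metis card_2_iff)
  then show ?thesis using path_hd_eq_last[OF cycle_repD(1)[OF r]] cycle_repD(5)[OF r] by simp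
qed

text \<open>This is the arc through the closing edge \<open>f\<close>: back from index
  \<open>i\<close> to 0, across \<open>f\<close>, and back from \<open>length es\<close> to
  \<open>j\<close>.\<close>

lemma path_outer:
  assumes r: "cycle_rep G Z f vs es" and ij: "i < j" "j \<le> length es"
  obtains ws fs where "is_path G ws fs" "hd ws = vs ! i" "last ws = vs ! j"
    "set ws = (!) vs ` ({..i} \<union> {j..length es})"
    "set fs = insert f ((!) es ` ({..<i} \<union> {j..<length es}))"
proof -
  note p = cycle_repD(1)[OF r]
  obtain vs1 es1 where 1: "is_path G vs1 es1" "hd vs1 = vs ! 0" "last vs1 = vs ! i"
    "set vs1 = (!) vs ` {0..i}" "set es1 = (!) es ` {0..<i}"
    using path_segment[OF p, of 0 i] ij by auto
  obtain vs2 es2 where 2: "is_path G vs2 es2" "hd vs2 = vs ! j" "last vs2 = vs ! length es"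
    "set vs2 = (!) vs ` {j..length es}" "set es2 = (!) es ` {j..<length es}"
    using path_segment[OF p, of j "length es"] ij by auto
  have disj: "set (rev vs1) \<inter> set (rev vs2) = {}"
    using 1(4) 2(4) ij path_nth_eq_iff[OF p] by fastforce
  have "ends G f = {last (rev vs1), hd (rev vs2)}"
    using path_rev_hd_last[OF 1(1)] path_rev_hd_last[OF 2(1)] 1 2 cycle_repD(4)[OF r]
      path_hd[OF p] path_last[OF p] by simp
  note j = path_join[OF path_rev[OF 1(1)] path_rev[OF 2(1)] disj cycle_repD(2)[OF r] this]
  have "set (rev vs1 @ rev vs2) = (!) vs ` ({..i} \<union> {j..length es})"
    using 1 2 by (auto simp: atMost_atLeast0)
  moreover have "set (rev es1 @ f # rev es2) = insert f ((!) es ` ({..<i} \<union> {j..<length es}))"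
    using 1 2 by (auto simp: lessThan_atLeast0)
  ultimately show ?thesis
    using that[OF j(1)] j(2,3) path_rev_hd_last[OF 1(1)] path_rev_hd_last[OF 2(1)] 1 2 by auto
qed

text \<open>The segment between the two indices and the arc of \<open>path_outer\<close> are the two
  arcs. Only increasing pairs of indices are treated directly; for the others both arcs are
  reversed.\<close>

lemma cycle_split:
  assumes Z: "is_cycle G Z" and xy: "x \<in> vertex_set G Z" "y \<in> vertex_set G Z" "x \<noteq> y"
  obtains vs es ws fs where "is_path G vs es" "is_path G ws fs" "hd vs = x" "last vs = y"
    "hd ws = x" "last ws = y" "set vs \<inter> set ws = {x, y}" "set es \<inter> set fs = {}"
    "set es \<union> set fs = Z" "set vs \<union> set ws = vertex_set G Z"
proof -
  obtain f us gs where r: "cycle_rep G Z f us gs" using Z by (rule cycle_rep_exists)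
  note p = cycle_repD(1)[OF r]
  have *: "\<exists>vs es ws fs. is_path G vs es \<and> is_path G ws fs \<and> hd vs = us ! i \<and> last vs = us ! j
      \<and> hd ws = us ! i \<and> last ws = us ! j \<and> set vs \<inter> set ws = {us ! i, us ! j} \<and> set es \<inter> set fs = {}
      \<and> set es \<union> set fs = Z \<and> set vs \<union> set ws = vertex_set G Z" if ij: "i < j" "j \<le> length gs" for i j
  proof -
    obtain vs es where 1: "is_path G vs es" "hd vs = us ! i" "last vs = us ! j"
      "set vs = (!) us ` {i..j}" "set es = (!) gs ` {i..<j}"
      using path_segment[OF p, of i j] ij by auto
    obtain ws fs where 2: "is_path G ws fs" "hd ws = us ! i" "last ws = us ! j"
      "set ws = (!) us ` ({..i} \<union> {j..length gs})"
      "set fs = insert f ((!) gs ` ({..<i} \<union> {j..<length gs}))"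
      using path_outer[OF r ij] .
    have inj: "inj_on ((!) us) {..length gs}" using path_nth_eq_iff[OF p] by (auto intro: inj_onI)
    have "set vs \<inter> set ws = (!) us ` ({i..j} \<inter> ({..i} \<union> {j..length gs}))"
      unfolding 1 2 using ij by (intro inj_on_image_Int[OF inj, symmetric]) auto
    also have "{i..j} \<inter> ({..i} \<union> {j..length gs}) = {i, j}" using ij by auto
    finally have a: "set vs \<inter> set ws = {us ! i, us ! j}" by simp
    have injg: "inj_on ((!) gs) {..<length gs}"
      using path_edges_distinct[OF p] by (auto intro: inj_onI simp: distinct_conv_nth)
    have "(!) gs ` {i..<j} \<inter> (!) gs ` ({..<i} \<union> {j..<length gs})
        = (!) gs ` ({i..<j} \<inter> ({..<i} \<union> {j..<length gs}))"
      using ij by (intro inj_on_image_Int[OF injg, symmetric]) auto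
    also have "{i..<j} \<inter> ({..<i} \<union> {j..<length gs}) = {}" using ij by auto
    finally have "(!) gs ` {i..<j} \<inter> (!) gs ` ({..<i} \<union> {j..<length gs}) = {}" by simp
    moreover have "f \<notin> (!) gs ` {i..<j}" using cycle_repD(3)[OF r] ij by auto
    ultimately have b: "set es \<inter> set fs = {}" unfolding 1 2 by blast
    have "set es \<union> set fs = insert f ((!) gs ` ({i..<j} \<union> ({..<i} \<union> {j..<length gs})))"
      unfolding 1 2 by (simp only: image_Un Un_insert_right)
    also have "{i..<j} \<union> ({..<i} \<union> {j..<length gs}) = {..<length gs}" using ij by auto
    also have "(!) gs ` {..<length gs} = set gs" by (auto simp: in_set_conv_nth)
    finally have c: "set es \<union> set fs = Z" using cycle_repD(5)[OF r] by simp
    have "set vs \<union> set ws = (!) us ` ({i..j} \<union> ({..i} \<union> {j..length gs}))"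
      unfolding 1 2 by (simp only: image_Un)
    also have "{i..j} \<union> ({..i} \<union> {j..length gs}) = {..length gs}" using ij by auto
    finally have "set vs \<union> set ws = vertex_set G Z"
      using cycle_rep_vertex_set[OF r] path_set[OF p] by simp
    then show ?thesis using 1(1-3) 2(1-3) a b c by blast
  qed
  obtain i j where ij: "x = us ! i" "y = us ! j" "i \<le> length gs" "j \<le> length gs"
    using xy cycle_rep_vertex_set[OF r] path_set[OF p] by auto
  then have "i \<noteq> j" using xy by auto
  then consider "i < j" | "j < i" by linarith
  then show ?thesis
  proof cases
    case 1
    then show ?thesis using *[OF 1 ij(4)] ij that by blast
  next
    case 2
    obtain vs es ws fs where o: "is_path G vs es" "is_path G ws fs" "hd vs = y" "last vs = x"
      "hd ws = y" "last ws = x" "set vs \<inter> set ws = {y, x}" "set es \<inter> set fs = {}"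
      "set es \<union> set fs = Z" "set vs \<union> set ws = vertex_set G Z"
      using *[OF 2 ij(3)] ij by blast
    show ?thesis
      using that[OF path_rev[OF o(1)] path_rev[OF o(2)]] path_rev_hd_last[OF o(1)]
        path_rev_hd_last[OF o(2)] o by (simp add: insert_commute)
  qed
qed

text \<open>The ends of the ear split the cycle into two arcs, and the ear is the third path of the
  theta.\<close>

lemma theta_of_ear:
  assumes Z: "is_cycle G Z" and p: "is_path G ws fs" and ne: "fs \<noteq> []"
    and ends: "set ws \<inter> vertex_set G Z = {hd ws, last ws}" and disj: "set fs \<inter> Z = {}"
  shows "is_theta G (Z \<union> set fs)"
proof -
  have xy: "hd ws \<in> vertex_set G Z" "last ws \<in> vertex_set G Z" "hd ws \<noteq> last ws"
    using ends path_hd_eq_last[OF p] ne by auto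
  obtain vs1 es1 vs2 es2 where o: "is_path G vs1 es1" "is_path G vs2 es2" "hd vs1 = hd ws"
    "last vs1 = last ws" "hd vs2 = hd ws" "last vs2 = last ws" "set vs1 \<inter> set vs2 = {hd ws, last ws}"
    "set es1 \<inter> set es2 = {}" "set es1 \<union> set es2 = Z" "set vs1 \<union> set vs2 = vertex_set G Z"
    using cycle_split[OF Z xy] .
  have "{hd ws, last ws} \<subseteq> set vs1" "{hd ws, last ws} \<subseteq> set vs2"
    using o(7) by auto
  then have "set vs1 \<inter> set ws = {hd ws, last ws}" "set vs2 \<inter> set ws = {hd ws, last ws}"
    using ends o(10) path_hd_in[OF p] path_last_in[OF p] by blast+
  moreover have "set es1 \<inter> set fs = {}" "set es2 \<inter> set fs = {}" using o(9) disj by blast+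
  ultimately show ?thesis
    unfolding is_theta_def using o(1-9) p xy(3)
    by (intro exI[of _ "hd ws"] exI[of _ "last ws"] exI[of _ vs1] exI[of _ es1] exI[of _ vs2]
        exI[of _ es2] exI[of _ ws] exI[of _ fs]) simp
qed

text \<open>\<open>is_cycle\<close> wants one path and one closing edge: the first edge of
  \<open>fs\<close> closes, and the rest of the second path is reversed and appended to the first
  path.\<close>

lemma cycle_of_two_paths:
  assumes p: "is_path G vs es" and q: "is_path G ws fs"
    and hl: "hd ws = hd vs" "last ws = last vs" and ne: "hd vs \<noteq> last vs"
    and int: "set vs \<inter> set ws = {hd vs, last vs}" and disj: "set es \<inter> set fs = {}"
  shows "is_cycle G (set es \<union> set fs)"
proof -
  define m where "m = length fs"
  have m: "0 < m" using ne hl path_hd_eq_last[OF q] unfolding m_def by (cases fs) auto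
  have fg: "fs ! i \<in> edges G" if "i < m" for i
    using path_edges[OF q] that nth_mem unfolding m_def by blast
  have sfs: "set fs = (!) fs ` {..<m}" unfolding m_def by (auto simp: in_set_conv_nth)
  show ?thesis
  proof (cases "m = 1")
    case True
    then have s: "set fs = {fs ! 0}" using sfs by (simp add: lessThan_Suc)
    have "ends G (fs ! 0) = {hd vs, last vs}"
      using path_ends_nth[OF q, of 0] True hl path_hd[OF q] path_last[OF q] unfolding m_def by simp
    then have "cycle_rep G (set es \<union> set fs) (fs ! 0) vs es"
      using p fg[OF m] s disj unfolding cycle_rep_def by auto
    then show ?thesis by (rule cycle_rep_is_cycle)
  next
    case False
    then have m1: "1 \<le> m - 1" using m by linarith
    have m2: "m - 1 \<le> length fs" unfolding m_def by simp
    \<comment> \<open>\<open>us\<close> is the second path without its two ends; it may consist of a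
      single vertex.\<close>
    obtain us gs where o: "is_path G us gs" "hd us = ws ! 1" "last us = ws ! (m - 1)"
      "set us = (!) ws ` {1..m - 1}" "set gs = (!) fs ` {1..<m - 1}"
      using path_segment[OF q m1 m2] .
    have "ws ! k \<noteq> hd ws \<and> ws ! k \<noteq> last ws" if "k \<in> {1..m - 1}" for k
    proof -
      have "k \<le> length fs" "k \<noteq> 0" "k \<noteq> length fs" using that m unfolding m_def by auto
      then show ?thesis
        using path_nth_eq_iff[OF q, of k 0] path_nth_eq_iff[OF q, of k "length fs"]
          path_hd[OF q] path_last[OF q] by simp
    qed
    then have nin: "hd vs \<notin> set us" "last vs \<notin> set us" unfolding o(4) hl[symmetric] by fastforce+
    have "set us \<subseteq> set ws" using o(4) path_set[OF q] m unfolding m_def by auto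
    then have "set vs \<inter> set us \<subseteq> {hd vs, last vs}" using int by blast
    then have d: "set vs \<inter> set (rev us) = {}" using nin by auto
    have e1: "ends G (fs ! (m - 1)) = {last vs, hd (rev us)}"
      using path_ends_nth[OF q, of "m - 1"] m hl path_last[OF q] path_rev_hd_last[OF o(1)] o
      unfolding m_def by (auto simp: insert_commute)
    have fm: "fs ! (m - 1) \<in> edges G" using fg m by simp
    note j = path_join[OF p path_rev[OF o(1)] d fm e1]
    have idx: "{..<m} = insert 0 (insert (m - 1) {1..<m - 1})" using m by auto
    have s: "set fs = insert (fs ! 0) (insert (fs ! (m - 1)) (set gs))"
      unfolding sfs o idx by simp
    have ne0: "fs ! 0 \<noteq> fs ! k" if "0 < k" "k < m" for k
      using that m path_edges_distinct[OF q] unfolding m_def by (simp add: nth_eq_iff_index_eq)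
    have "fs ! 0 \<notin> set gs"
    proof
      assume "fs ! 0 \<in> set gs"
      then obtain k where "fs ! 0 = fs ! k" "1 \<le> k" "k < m - 1" unfolding o(5) by auto
      then show False using ne0[of k] by simp
    qed
    moreover have "fs ! 0 \<noteq> fs ! (m - 1)" using ne0[of "m - 1"] m1 by simp
    moreover have "fs ! 0 \<notin> set es" using disj m unfolding m_def by auto
    moreover have "ends G (fs ! 0) = {hd vs, ws ! 1}"
      using path_ends_nth[OF q, of 0] m hl path_hd[OF q] unfolding m_def by simp
    moreover have "set es \<union> set fs = insert (fs ! 0) (set (es @ fs ! (m - 1) # rev gs))"
      unfolding s by auto
    moreover have "last (vs @ rev us) = ws ! 1" using j(3) path_rev_hd_last[OF o(1)] o(2) by simp
    ultimately have "cycle_rep G (set es \<union> set fs) (fs ! 0) (vs @ rev us) (es @ fs ! (m - 1) # rev gs)"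
      using j(1,2) fg[OF m] unfolding cycle_rep_def by simp
    then show ?thesis by (rule cycle_rep_is_cycle)
  qed
qed

text \<open>The path is trimmed around \<open>e\<close>: back to the last vertex of \<open>W\<close>
  before \<open>e\<close>, and on to the first one behind it.\<close>

lemma path_ear:
  assumes p: "is_path G vs es" and W: "hd vs \<in> W" "last vs \<in> W" and e: "e \<in> set es"
  obtains ws fs where "is_path G ws fs" "e \<in> set fs" "set fs \<subseteq> set es"
    "set ws \<inter> W = {hd ws, last ws}"
proof -
  obtain k where k: "k < length es" "e = es ! k" using e unfolding in_set_conv_nth by blast
  define i where "i = (GREATEST i. i \<le> k \<and> vs ! i \<in> W)"
  define j where "j = (LEAST j. k < j \<and> j \<le> length es \<and> vs ! j \<in> W)"
  have i: "i \<le> k \<and> vs ! i \<in> W"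
    unfolding i_def by (rule GreatestI_nat[where k = 0 and b = k]) (use W path_hd[OF p] in auto)
  have imax: "m \<le> i" if "m \<le> k" "vs ! m \<in> W" for m
    unfolding i_def by (rule Greatest_le_nat[where b = k]) (use that in auto)
  have j: "k < j \<and> j \<le> length es \<and> vs ! j \<in> W"
    unfolding j_def by (rule LeastI[where k = "length es"]) (use W path_last[OF p] k in auto)
  have jmin: "j \<le> m" if "k < m" "m \<le> length es" "vs ! m \<in> W" for m
    unfolding j_def by (rule Least_le) (use that in auto)
  have ij: "i \<le> j" "j \<le> length es" using i j by auto
  obtain ws fs where o: "is_path G ws fs" "hd ws = vs ! i" "last ws = vs ! j"
    "set ws = (!) vs ` {i..j}" "set fs = (!) es ` {i..<j}" using path_segment[OF p ij] .
  have "set ws \<inter> W \<subseteq> {vs ! i, vs ! j}"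
  proof
    fix v assume "v \<in> set ws \<inter> W"
    then obtain m where m: "i \<le> m" "m \<le> j" "v = vs ! m" "vs ! m \<in> W" using o(4) by auto
    then have "m = i \<or> m = j" using imax[of m] jmin[of m] ij by (cases "m \<le> k") auto
    then show "v \<in> {vs ! i, vs ! j}" using m by auto
  qed
  then have "set ws \<inter> W = {hd ws, last ws}" using o i j ij by auto
  moreover have "e \<in> set fs" "set fs \<subseteq> set es" using o k i j by auto
  ultimately show ?thesis using that[OF o(1)] by blast
qed

text \<open>The trimmed path ends at the first visit to \<open>B\<close> (index \<open>j\<close>)
  and begins at the last visit to \<open>A\<close> before that (index \<open>i\<close>).\<close>

lemma path_minimal:
  assumes p: "is_path G vs es" and AB: "hd vs \<in> A" "last vs \<in> B" "A \<inter> B = {}"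
  obtains ws fs where "is_path G ws fs" "set fs \<subseteq> set es"
    "set ws \<inter> A = {hd ws}" "set ws \<inter> B = {last ws}"
proof -
  define j where "j = (LEAST j. j \<le> length es \<and> vs ! j \<in> B)"
  define i where "i = (GREATEST i. i \<le> j \<and> vs ! i \<in> A)"
  have j: "j \<le> length es \<and> vs ! j \<in> B"
    unfolding j_def by (rule LeastI[where k = "length es"]) (use AB path_last[OF p] in auto)
  have jmin: "j \<le> m" if "m \<le> length es" "vs ! m \<in> B" for m
    unfolding j_def by (rule Least_le) (use that in auto)
  have i: "i \<le> j \<and> vs ! i \<in> A"
    unfolding i_def by (rule GreatestI_nat[where k = 0 and b = j]) (use AB path_hd[OF p] in auto)
  have imax: "m \<le> i" if "m \<le> j" "vs ! m \<in> A" for m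
    unfolding i_def by (rule Greatest_le_nat[where b = j]) (use that in auto)
  have ij: "i \<le> j" "j \<le> length es" using i j by auto
  obtain ws fs where o: "is_path G ws fs" "hd ws = vs ! i" "last ws = vs ! j"
    "set ws = (!) vs ` {i..j}" "set fs = (!) es ` {i..<j}" using path_segment[OF p ij] .
  have "v = hd ws" if "v \<in> set ws" "v \<in> A" for v
  proof -
    obtain m where "i \<le> m" "m \<le> j" "v = vs ! m" using \<open>v \<in> set ws\<close> o(4) by auto
    then show ?thesis using imax[of m] o(2) \<open>v \<in> A\<close> by simp
  qed
  moreover have "hd ws \<in> A" using i o(2) by simp
  ultimately have A: "set ws \<inter> A = {hd ws}" using path_hd_in[OF o(1)] by blast
  have "v = last ws" if "v \<in> set ws" "v \<in> B" for v
  proof -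
    obtain m where "i \<le> m" "m \<le> j" "v = vs ! m" using \<open>v \<in> set ws\<close> o(4) by auto
    then show ?thesis using jmin[of m] ij o(3) \<open>v \<in> B\<close> by simp
  qed
  moreover have "last ws \<in> B" using j o(3) by simp
  ultimately have B: "set ws \<inter> B = {last ws}" using path_last_in[OF o(1)] by blast
  have "set fs \<subseteq> set es" using o(5) ij by auto
  then show ?thesis using that[OF o(1) _ A B] by blast
qed

section \<open>Connected edge sets\<close>

definition reachable :: "('v, 'e) multigraph \<Rightarrow> 'e set \<Rightarrow> 'v \<Rightarrow> 'v \<Rightarrow> bool" where
  "reachable G S = (\<lambda>a b. \<exists>e \<in> S. ends G e = {a, b})\<^sup>*\<^sup>*"

definition connected_edges :: "('v, 'e) multigraph \<Rightarrow> 'e set \<Rightarrow> bool" where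
  "connected_edges G S \<longleftrightarrow> (\<forall>u \<in> vertex_set G S. \<forall>v \<in> vertex_set G S. reachable G S u v)"

lemma reachable_trans: "reachable G S u v \<Longrightarrow> reachable G S v w \<Longrightarrow> reachable G S u w"
  unfolding reachable_def by auto

lemma reachable_mono: "S \<subseteq> T \<Longrightarrow> reachable G S u v \<Longrightarrow> reachable G T u v"
  unfolding reachable_def
  by (erule rev_predicate2D, rule rtranclp_mono) blast

text \<open>The walk is followed step by step; whenever it returns to a vertex of the path built so
  far, the path is cut off there, which keeps the vertices distinct.\<close>

lemma reachable_path:
  assumes "reachable G S u v" and u: "u \<in> verts G" and S: "S \<subseteq> edges G"
    and fin: "finite_multigraph G"
  shows "\<exists>vs es. is_path G vs es \<and> set es \<subseteq> S \<and> hd vs = u \<and> last vs = v"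
  using assms(1) unfolding reachable_def
proof (induction rule: rtranclp_induct)
  case base
  show ?case using path_singleton[OF u] by (intro exI[of _ "[u]"] exI[of _ "[]"]) auto
next
  case (step v w)
  obtain vs es where p: "is_path G vs es" "set es \<subseteq> S" "hd vs = u" "last vs = v"
    using step.IH by blast
  obtain e where e: "e \<in> S" "ends G e = {v, w}" using step.hyps by blast
  show ?case
  proof (cases "w \<in> set vs")
    case True
    then obtain j where j: "j \<le> length es" "w = vs ! j" using path_set[OF p(1)] by auto
    obtain ws fs where o: "is_path G ws fs" "hd ws = vs ! 0" "last ws = vs ! j"
      "set ws = (!) vs ` {0..j}" "set fs = (!) es ` {0..<j}"
      using path_segment[OF p(1) le0 j(1)] .
    have "set fs \<subseteq> S" using o(5) j p(2) by auto
    then show ?thesis using o p(3) j path_hd[OF p(1)] by metis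
  next
    case False
    have "w \<in> verts G" "e \<in> edges G" using e S fin unfolding finite_multigraph_def by blast+
    then have "is_path G (vs @ [w]) (es @ [e])" using path_snoc[OF p(1) _ False] e p by simp
    moreover have "hd (vs @ [w]) = u" using p path_lengths[OF p(1)] by (cases vs) auto
    ultimately show ?thesis using p e by (intro exI[of _ "vs @ [w]"] exI[of _ "es @ [e]"]) auto
  qed
qed

lemma path_reachable:
  assumes p: "is_path G vs es" and uv: "u \<in> set vs" "v \<in> set vs"
  shows "reachable G (set es) u v"
proof -
  have *: "reachable G (set es) (vs ! 0) (vs ! k) \<and> reachable G (set es) (vs ! k) (vs ! 0)"
    if "k \<le> length es" for k
    using that
  proof (induction k)
    case (Suc k)
    have e: "es ! k \<in> set es" "ends G (es ! k) = {vs ! k, vs ! Suc k}"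
      using Suc.prems path_ends_nth[OF p] by auto
    then have "reachable G (set es) (vs ! k) (vs ! Suc k)" "reachable G (set es) (vs ! Suc k) (vs ! k)"
      unfolding reachable_def by (auto intro!: r_into_rtranclp bexI[of _ "es ! k"])
    then show ?case using Suc reachable_trans by (metis Suc_leD)
  qed (auto simp: reachable_def)
  obtain i j where "i \<le> length es" "u = vs ! i" "j \<le> length es" "v = vs ! j"
    using uv path_set[OF p] by auto
  then show ?thesis using * by (metis reachable_trans)
qed

lemma path_connected: "is_path G vs es \<Longrightarrow> connected_edges G (set es)"
  unfolding connected_edges_def
  by (cases "es = []") (auto simp: path_vertex_set path_reachable vertex_set_def[of _ "{}"])

lemma cycle_connected:
  assumes "is_cycle G Z" shows "connected_edges G Z"
proof -
  obtain f vs es where r: "cycle_rep G Z f vs es" using assms by (rule cycle_rep_exists)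
  show ?thesis unfolding connected_edges_def cycle_rep_vertex_set[OF r]
    by (intro ballI reachable_mono[OF cycle_repD(7)[OF r]] path_reachable[OF cycle_repD(1)[OF r]])
qed

lemma connected_edges_Un:
  assumes S: "connected_edges G S" and T: "connected_edges G T"
    and ne: "vertex_set G S \<inter> vertex_set G T \<noteq> {}"
  shows "connected_edges G (S \<union> T)"
proof -
  obtain c where c: "c \<in> vertex_set G S" "c \<in> vertex_set G T" using ne by blast
  have "reachable G (S \<union> T) u c \<and> reachable G (S \<union> T) c u" if "u \<in> vertex_set G (S \<union> T)" for u
    using that S T c reachable_mono[of S "S \<union> T" G] reachable_mono[of T "S \<union> T" G]
    unfolding connected_edges_def vertex_set_Un by blast
  then show ?thesis unfolding connected_edges_def by (meson reachable_trans)
qed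

lemma connected_edges_path:
  assumes "connected_edges G S" "S \<subseteq> edges G" "finite_multigraph G"
    "u \<in> vertex_set G S" "v \<in> vertex_set G S"
  obtains vs es where "is_path G vs es" "set es \<subseteq> S" "hd vs = u" "last vs = v"
proof -
  have "u \<in> verts G" using assms unfolding finite_multigraph_def vertex_set_def by blast
  then show ?thesis using assms reachable_path[of G S u v] that unfolding connected_edges_def by blast
qed

text \<open>A walk in \<open>S\<close> that starts in \<open>W\<close> can never leave
  \<open>W\<close>.\<close>

lemma connected_edges_closed:
  assumes S: "connected_edges G S" and W: "\<And>e. e \<in> S \<Longrightarrow> ends G e \<subseteq> W \<or> ends G e \<inter> W = {}"
    and ne: "vertex_set G S \<inter> W \<noteq> {}"
  shows "vertex_set G S \<subseteq> W"
proof
  fix v assume v: "v \<in> vertex_set G S"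
  obtain u where u: "u \<in> vertex_set G S" "u \<in> W" using ne by blast
  have "reachable G S u v" using S u v unfolding connected_edges_def by blast
  then show "v \<in> W" unfolding reachable_def
  proof (induction rule: rtranclp_induct)
    case (step a b)
    then obtain e where e: "e \<in> S" "ends G e = {a, b}" by blast
    then show ?case using W[OF e(1)] step by auto
  qed (rule u)
qed

section \<open>Edge sets without pendant edges\<close>

text \<open>Minimum degree two, with loops exempt because a loop is a cycle by itself. All circuits
  of \<open>M\<close> have this property, so it serves as a test for what a cycle or a circuit can
  contain.\<close>

definition no_pendant :: "('v, 'e) multigraph \<Rightarrow> 'e set \<Rightarrow> bool" where
  "no_pendant G S \<longleftrightarrow> (\<forall>e \<in> S. \<forall>v \<in> ends G e. card (ends G e) = 2 \<longrightarrow> (\<exists>f \<in> S. f \<noteq> e \<and> v \<in> ends G f))"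

lemma no_pendantD:
  "no_pendant G S \<Longrightarrow> e \<in> S \<Longrightarrow> v \<in> ends G e \<Longrightarrow> card (ends G e) = 2 \<Longrightarrow> \<exists>f \<in> S. f \<noteq> e \<and> v \<in> ends G f"
  unfolding no_pendant_def by blast

lemma no_pendant_Un: "no_pendant G S \<Longrightarrow> no_pendant G T \<Longrightarrow> no_pendant G (S \<union> T)"
  unfolding no_pendant_def by blast

lemma cycle_no_pendant:
  assumes Z: "is_cycle G Z" shows "no_pendant G Z"
  unfolding no_pendant_def
proof (intro ballI impI)
  fix e v assume e: "e \<in> Z" "v \<in> ends G e" "card (ends G e) = 2"
  obtain vs es where r: "cycle_rep G Z e vs es" using cycle_rep_at[OF Z e(1)] .
  note p = cycle_repD(1)[OF r]
  have "es \<noteq> []" using e(3) path_hd_eq_last[OF p] cycle_repD(4)[OF r] by auto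
  then have s: "0 < length es" by simp
  have "v = vs ! 0 \<or> v = vs ! length es"
    using e(2) cycle_repD(4)[OF r] path_hd[OF p] path_last[OF p] by auto
  then have "v \<in> ends G (es ! 0) \<or> v \<in> ends G (es ! (length es - 1))"
    using path_ends_nth[OF p, of 0] path_ends_nth[OF p, of "length es - 1"] s by auto
  moreover have "es ! 0 \<in> set es" "es ! (length es - 1) \<in> set es" using s by auto
  ultimately show "\<exists>f\<in>Z. f \<noteq> e \<and> v \<in> ends G f" using cycle_repD(3,7)[OF r] by (metis subsetD)
qed

text \<open>The first edge of \<open>B\<close> along the path would be pendant at its earlier
  vertex.\<close>

lemma no_pendant_path_empty:
  assumes p: "is_path G vs es" and B: "no_pendant G B" "B \<subseteq> set es"
  shows "B = {}"
proof (rule ccontr)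
  assume "B \<noteq> {}"
  define m where "m = (LEAST m. m < length es \<and> es ! m \<in> B)"
  have "\<exists>m. m < length es \<and> es ! m \<in> B" using B(2) \<open>B \<noteq> {}\<close> by (metis all_not_in_conv in_set_conv_nth subsetD)
  then have m: "m < length es \<and> es ! m \<in> B" unfolding m_def by (rule LeastI_ex)
  have mmin: "m \<le> k" if "k < length es" "es ! k \<in> B" for k unfolding m_def by (rule Least_le) (use that in auto)
  have "vs ! m \<in> ends G (es ! m)" "card (ends G (es ! m)) = 2"
    using m path_ends_nth[OF p, of m] path_edge_card[OF p, of "es ! m"] by simp_all
  then obtain f where f: "f \<in> B" "f \<noteq> es ! m" "vs ! m \<in> ends G f" using no_pendantD[OF B(1)] m by blast
  then have "0 < m \<and> f = es ! (m - 1)" using path_edge_at[OF p, of f m] B(2) m by auto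
  moreover have "m - 1 < length es" using m by linarith
  ultimately show False using mmin[of "m - 1"] f(1) by (metis diff_less less_numeral_extra(1) not_le)
qed

text \<open>At an inner vertex of the path, \<open>B\<close> can use only the two path edges there,
  so membership in \<open>B\<close> spreads from each edge to the next.\<close>

lemma no_pendant_path_all:
  assumes p: "is_path G vs es" and B: "no_pendant G B" "B \<subseteq> T \<union> set es"
    and int: "\<And>k. 0 < k \<Longrightarrow> k < length es \<Longrightarrow> vs ! k \<notin> vertex_set G T"
    and ne: "B \<inter> set es \<noteq> {}"
  shows "set es \<subseteq> B"
proof -
  have step: "es ! k \<in> B \<longleftrightarrow> es ! Suc k \<in> B" if k: "Suc k < length es" for k
  proof -
    have only: "f = es ! k \<or> f = es ! Suc k" if "f \<in> B" "vs ! Suc k \<in> ends G f" for f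
    proof -
      have "f \<notin> T" using int[of "Suc k"] k that(2) unfolding vertex_set_def by auto
      then have "f \<in> set es" using B(2) that(1) by blast
      then show ?thesis using path_edge_at[OF p, of f "Suc k"] that k by auto
    qed
    have e: "vs ! Suc k \<in> ends G (es ! k)" "vs ! Suc k \<in> ends G (es ! Suc k)"
      "card (ends G (es ! k)) = 2" "card (ends G (es ! Suc k)) = 2"
      using path_ends_nth[OF p, of k] path_ends_nth[OF p, of "Suc k"]
        path_edge_card[OF p, of "es ! k"] path_edge_card[OF p, of "es ! Suc k"] k by simp_all
    show ?thesis
      using no_pendantD[OF B(1) _ e(1,3)] no_pendantD[OF B(1) _ e(2,4)] only by metis
  qed
  obtain k where k: "k < length es" "es ! k \<in> B" using ne by (auto simp: in_set_conv_nth)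
  have "es ! 0 \<in> B \<longleftrightarrow> es ! m \<in> B" if "m < length es" for m using that
    by (induction m) (use step in auto)
  then have "es ! m \<in> B" if "m < length es" for m using k that by blast
  then show ?thesis by (auto simp: in_set_conv_nth)
qed

text \<open>If an edge \<open>f\<close> of \<open>Z\<close> were missing from \<open>B\<close>, then
  \<open>B\<close> would lie in the path obtained by opening \<open>Z\<close> at
  \<open>f\<close>.\<close>

lemma cycle_subset_eq:
  assumes "is_cycle G B" "is_cycle G Z" "B \<subseteq> Z"
  shows "B = Z"
proof (rule ccontr)
  assume "B \<noteq> Z"
  then obtain f where f: "f \<in> Z" "f \<notin> B" using assms(3) by blast
  obtain vs es where r: "cycle_rep G Z f vs es" using cycle_rep_at[OF assms(2) f(1)] .
  have "B \<subseteq> set es" using assms(3) f cycle_repD(5)[OF r] by auto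
  then show False
    using no_pendant_path_empty[OF cycle_repD(1)[OF r] cycle_no_pendant[OF assms(1)]]
      cycle_nonempty[OF assms(1)] by blast
qed

section \<open>Thetas and handcuffs\<close>

text \<open>Two of the three cycles of a theta already cover it; both contain the first path, which
  supplies common vertices.\<close>

lemma theta_cyclesE:
  assumes "is_theta G T"
  obtains Z1 Z2 where "is_cycle G Z1" "is_cycle G Z2" "T = Z1 \<union> Z2"
    "vertex_set G Z1 \<inter> vertex_set G Z2 \<noteq> {}"
proof -
  obtain u v vs1 es1 vs2 es2 vs3 es3 where
    uv: "u \<noteq> v" and
    p: "is_path G vs1 es1" "is_path G vs2 es2" "is_path G vs3 es3" and
    h: "hd vs1 = u" "hd vs2 = u" "hd vs3 = u" "last vs1 = v" "last vs2 = v" "last vs3 = v" and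
    d: "set vs1 \<inter> set vs2 = {u, v}" "set vs1 \<inter> set vs3 = {u, v}"
      "set es1 \<inter> set es2 = {}" "set es1 \<inter> set es3 = {}" and
    T: "T = set es1 \<union> set es2 \<union> set es3"
    using assms unfolding is_theta_def by auto
  have c: "is_cycle G (set es1 \<union> set es2)" "is_cycle G (set es1 \<union> set es3)"
    using cycle_of_two_paths[OF p(1,2)] cycle_of_two_paths[OF p(1,3)] h d uv by auto
  have "es1 \<noteq> []" using path_hd_eq_last[OF p(1)] h uv by auto
  then obtain w where "w \<in> vertex_set G (set es1)"
    using path_vertex_set[OF p(1)] path_hd_in[OF p(1)] by blast
  then have "vertex_set G (set es1 \<union> set es2) \<inter> vertex_set G (set es1 \<union> set es3) \<noteq> {}"
    unfolding vertex_set_Un by blast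
  then show ?thesis using that[OF c] T by blast
qed

text \<open>The definition admits a path with one vertex, but that vertex would lie on both of the
  disjoint cycles.\<close>

lemma loose_handcuff_path:
  assumes "is_loose_handcuff G C1 C2 H"
  obtains vs es where "is_path G vs es" "set vs \<inter> vertex_set G C1 = {hd vs}"
    "set vs \<inter> vertex_set G C2 = {last vs}" "H = C1 \<union> C2 \<union> set es" "es \<noteq> []"
proof -
  obtain vs es where o: "is_path G vs es" "set vs \<inter> vertex_set G C1 = {hd vs}"
    "set vs \<inter> vertex_set G C2 = {last vs}" "H = C1 \<union> C2 \<union> set es"
    using assms unfolding is_loose_handcuff_def by blast
  have "hd vs \<noteq> last vs" using o(2,3) assms unfolding is_loose_handcuff_def by blast
  then show ?thesis using that[OF o] path_hd_eq_last[OF o(1)] by blast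
qed

lemma loose_handcuff_no_pendant:
  assumes H: "is_loose_handcuff G C1 C2 H"
  shows "no_pendant G H"
proof -
  obtain vs es where o: "is_path G vs es" "set vs \<inter> vertex_set G C1 = {hd vs}"
    "set vs \<inter> vertex_set G C2 = {last vs}" "H = C1 \<union> C2 \<union> set es" "es \<noteq> []"
    using loose_handcuff_path[OF H] .
  note p = o(1)
  have C: "is_cycle G C1" "is_cycle G C2" using H unfolding is_loose_handcuff_def by auto
  \<comment> \<open>A path edge has two ends, while the path shares only one vertex with each
    cycle.\<close>
  have notin: "f \<notin> set es" if "f \<in> C1 \<union> C2" for f
  proof
    assume f: "f \<in> set es"
    have "ends G f \<subseteq> set vs \<inter> vertex_set G C1 \<or> ends G f \<subseteq> set vs \<inter> vertex_set G C2"
      using that path_ends_in_set[OF p f] unfolding vertex_set_def by blast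
    then have "card (ends G f) \<le> 1" unfolding o(2,3) using card_mono[of "{_}" "ends G f"] by fastforce
    then show False using path_edge_card[OF p f] by simp
  qed
  \<comment> \<open>At an inner vertex of the path the second edge is the neighbouring path edge; at
    an end of the path it is an edge of the cycle attached there.\<close>
  have at: "\<exists>f\<in>H. f \<noteq> e \<and> v \<in> ends G f" if e: "e \<in> set es" and v: "v \<in> ends G e" for e v
  proof -
    obtain i where i: "i < length es" "e = es ! i" using e by (auto simp: in_set_conv_nth)
    have dist: "es ! a \<noteq> es ! b" if "a < length es" "b < length es" "a \<noteq> b" for a b
      using path_edges_distinct[OF p] that by (simp add: distinct_conv_nth)
    have "v = vs ! i \<or> v = vs ! Suc i" using v i path_ends_nth[OF p] by auto
    then consider "v = hd vs" | "v = last vs" | "v = vs ! i" "0 < i" | "v = vs ! Suc i" "Suc i < length es"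
      using i path_hd[OF p] path_last[OF p] by (metis Suc_lessI not_gr_zero)
    then show ?thesis
    proof cases
      case 1
      then obtain f where f: "f \<in> C1" "v \<in> ends G f" using o(2) unfolding vertex_set_def by blast
      then have "f \<noteq> e" using notin[of f] e by auto
      then show ?thesis using f o(4) by blast
    next
      case 2
      then obtain f where f: "f \<in> C2" "v \<in> ends G f" using o(3) unfolding vertex_set_def by blast
      then have "f \<noteq> e" using notin[of f] e by auto
      then show ?thesis using f o(4) by blast
    next
      case 3
      then have "es ! (i - 1) \<in> H" "es ! (i - 1) \<noteq> e" "v \<in> ends G (es ! (i - 1))"
        using i o(4) path_ends_nth[OF p, of "i - 1"] dist[of "i - 1" i] by auto
      then show ?thesis by blast
    next
      case 4
      then have "es ! Suc i \<in> H" "es ! Suc i \<noteq> e" "v \<in> ends G (es ! Suc i)"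
        using i o(4) path_ends_nth[OF p, of "Suc i"] dist[of "Suc i" i] by auto
      then show ?thesis by blast
    qed
  qed
  have "no_pendant G (C1 \<union> C2)" using C cycle_no_pendant no_pendant_Un by blast
  then show ?thesis unfolding no_pendant_def using at o(4) by blast
qed

lemma loose_handcuff_connected:
  assumes H: "is_loose_handcuff G C1 C2 H"
  shows "connected_edges G H"
proof -
  obtain vs es where o: "is_path G vs es" "set vs \<inter> vertex_set G C1 = {hd vs}"
    "set vs \<inter> vertex_set G C2 = {last vs}" "H = C1 \<union> C2 \<union> set es" "es \<noteq> []"
    using loose_handcuff_path[OF H] .
  have C: "is_cycle G C1" "is_cycle G C2" using H unfolding is_loose_handcuff_def by auto
  have V: "vertex_set G (set es) = set vs" by (rule path_vertex_set[OF o(1,5)])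
  have "vertex_set G C1 \<inter> vertex_set G (set es) \<noteq> {}" using o(2) V by auto
  note 1 = connected_edges_Un[OF cycle_connected[OF C(1)] path_connected[OF o(1)] this]
  have "vertex_set G (C1 \<union> set es) \<inter> vertex_set G C2 \<noteq> {}"
    using o(3) unfolding vertex_set_Un V by auto
  note connected_edges_Un[OF 1 cycle_connected[OF C(2)] this]
  moreover have "(C1 \<union> set es) \<union> C2 = H" using o(4) by auto
  ultimately show ?thesis by simp
qed

section \<open>Two-separations of an unbreakable quasi-biased matroid\<close>

lemma path_edge_between_ends:
  assumes p: "is_path G vs es" and e: "e \<in> set es" "ends G e \<subseteq> {hd vs, last vs}"
  shows "es = [e]"
proof -
  obtain i where i: "i < length es" "e = es ! i" using e(1) by (auto simp: in_set_conv_nth)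
  have "{vs ! i, vs ! Suc i} \<subseteq> {vs ! 0, vs ! length es}"
    using e(2) i path_ends_nth[OF p i(1)] path_hd[OF p] path_last[OF p] by simp
  then have "i = 0" "Suc i = length es"
    using i path_nth_eq_iff[OF p, of i 0] path_nth_eq_iff[OF p, of i "length es"]
      path_nth_eq_iff[OF p, of "Suc i" 0] path_nth_eq_iff[OF p, of "Suc i" "length es"] by auto
  then show ?thesis using i by (cases es) auto
qed

lemma vertex_disjoint_edges_disjoint:
  assumes "finite_multigraph G" "vertex_disjoint G S T" "S \<subseteq> edges G"
  shows "S \<inter> T = {}"
proof (rule ccontr)
  assume "S \<inter> T \<noteq> {}"
  then obtain e where e: "e \<in> S" "e \<in> T" by blast
  then have "ends G e \<noteq> {}" using assms(1,3) unfolding finite_multigraph_def by force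
  then show False using assms(2) e unfolding vertex_set_def by blast
qed

text \<open>A path in \<open>S\<close> between the ends of the ear closes it to a cycle. That this
  path starts at \<open>hd ws\<close> is recorded because \<open>F_meets_side\<close> inspects its
  first edge.\<close>

lemma cycle_of_ear:
  assumes S: "connected_edges G S" "S \<subseteq> edges G" "finite_multigraph G"
    and p: "is_path G ws fs" "fs \<noteq> []" "set ws \<inter> vertex_set G S = {hd ws, last ws}"
    and disj: "set fs \<inter> S = {}"
  obtains vs es where "is_path G vs es" "set es \<subseteq> S" "es \<noteq> []" "hd vs = hd ws"
    "is_cycle G (set es \<union> set fs)"
proof -
  have ne: "hd ws \<noteq> last ws" using path_hd_eq_last[OF p(1)] p(2) by simp
  have "hd ws \<in> vertex_set G S" "last ws \<in> vertex_set G S" using p(3) by auto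
  then obtain vs es where q: "is_path G vs es" "set es \<subseteq> S" "hd vs = hd ws" "last vs = last ws"
    using connected_edges_path[OF S] by metis
  have qne: "es \<noteq> []" using path_hd_eq_last[OF q(1)] q ne by metis
  have "set vs \<subseteq> vertex_set G S"
    using path_vertex_set[OF q(1) qne] vertex_set_mono[OF q(2), of G] by simp
  moreover have "{hd vs, last vs} \<subseteq> set vs" "{hd ws, last ws} \<subseteq> set ws"
    using path_hd_in[OF q(1)] path_last_in[OF q(1)] path_hd_in[OF p(1)] path_last_in[OF p(1)] by auto
  ultimately have "set vs \<inter> set ws = {hd vs, last vs}" using p(3) q(3,4) by auto
  moreover have "set es \<inter> set fs = {}" using disj q(2) by auto
  ultimately have "is_cycle G (set es \<union> set fs)"
    using cycle_of_two_paths[OF q(1) p(1)] q(3,4) ne by simp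
  then show ?thesis using that[OF q(1,2) qne q(3)] by blast
qed

text \<open>The assumptions describe the situation to be refuted. \<open>X\<close> stands for either
  side of the separation: \<open>swap_sides\<close> makes every lemma available for the complement
  as well.\<close>

locale quasi_biased_2_separation = matroid M
  for M :: "'e pre_matroid" +
  fixes G :: "('v, 'e) multigraph" and \<B> \<L> \<F> :: "'e set set" and X :: "'e set"
  assumes quasi_biased: "quasi_biased_graph G \<B> \<L> \<F>"
    and nondegenerate_L: "\<not> degenerate G \<L>"
    and nondegenerate_F: "\<not> degenerate G \<F>"
    and quasi_biased_matroid: "is_quasi_biased_matroid G \<B> \<L> \<F> M"
    and simple: "simple_matroid M"
    and unbreakable: "unbreakable_matroid M"
    and separation: "matroid_separation M 2 X"
begin

abbreviation "E \<equiv> edges G"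
abbreviation "V \<equiv> vertex_set G (edges G)"

definition crossing :: "'e set \<Rightarrow> bool" where
  "crossing C \<longleftrightarrow> C \<inter> X \<noteq> {} \<and> C - X \<noteq> {}"

section \<open>Immediate consequences of the assumptions\<close>

lemma finite_G: "finite_multigraph G"
  using quasi_biased unfolding quasi_biased_graph_def by simp

lemma ground_eq: "ground M = E"
  using quasi_biased_matroid unfolding is_quasi_biased_matroid_def by simp

lemma circuit_iff: "matroid_circuit M C \<longleftrightarrow> quasi_biased_circuit G \<B> \<L> \<F> C"
  using quasi_biased_matroid unfolding is_quasi_biased_matroid_def by simp

lemma connected: "connected_matroid M"
  using unbreakable unfolding unbreakable_matroid_def by simp

lemma cycle_classes: "\<B> \<union> \<L> \<union> \<F> = {C. is_cycle G C}"
  using quasi_biased unfolding quasi_biased_graph_def by simp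

lemma cycle_if_class: "C \<in> \<B> \<Longrightarrow> is_cycle G C" "C \<in> \<L> \<Longrightarrow> is_cycle G C" "C \<in> \<F> \<Longrightarrow> is_cycle G C"
  using cycle_classes by blast+

lemma class_disjoint: "C \<in> \<L> \<Longrightarrow> C \<notin> \<B>" "C \<in> \<F> \<Longrightarrow> C \<notin> \<B>"
  using quasi_biased unfolding quasi_biased_graph_def by blast+

lemma unbalanced_cycle: "is_cycle G C \<Longrightarrow> C \<notin> \<B> \<Longrightarrow> C \<in> \<L> \<or> C \<in> \<F>"
  using cycle_classes by blast

lemma L_meets_F: "C \<in> \<L> \<Longrightarrow> D \<in> \<F> \<Longrightarrow> vertex_set G C \<inter> vertex_set G D \<noteq> {}"
  using quasi_biased unfolding quasi_biased_graph_def by blast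

lemma finite_E: "finite E" using finite_G unfolding finite_multigraph_def by simp

lemma finite_V: "finite V"
  using finite_G finite_subset unfolding finite_multigraph_def vertex_set_def by (metis UN_least)

lemma ends_card: "e \<in> E \<Longrightarrow> card (ends G e) = 1 \<or> card (ends G e) = 2"
  using finite_G unfolding finite_multigraph_def by blast

lemma ends_nonempty: "e \<in> E \<Longrightarrow> ends G e \<noteq> {}"
  using ends_card by fastforce

lemma X_subset: "X \<subseteq> E"
  using separation ground_eq unfolding matroid_separation_def by simp

section \<open>Circuits, connectivity of the graph, and crossing circuits\<close>

lemma circuit_no_pendant:
  assumes "matroid_circuit M C" shows "no_pendant G C"
  using assms unfolding circuit_iff quasi_biased_circuit_def
proof (elim disjE exE bexE conjE)
  assume "C \<in> \<B>"
  then show ?thesis by (intro cycle_no_pendant cycle_if_class)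
next
  assume "is_theta G C"
  then show ?thesis by (rule theta_cyclesE) (simp add: cycle_no_pendant no_pendant_Un)
next
  fix C1 C2 assume "is_tight_handcuff G C1 C2 C"
  then show ?thesis unfolding is_tight_handcuff_def by (simp add: cycle_no_pendant no_pendant_Un)
next
  fix C1 C2 assume "C1 \<in> \<L>" "C2 \<in> \<L>" "C = C1 \<union> C2"
  then show ?thesis by (simp add: cycle_if_class cycle_no_pendant no_pendant_Un)
next
  fix C1 C2 assume "is_loose_handcuff G C1 C2 C"
  then show ?thesis by (rule loose_handcuff_no_pendant)
qed

text \<open>Every circuit is connected as an edge set, except a union of two disjoint cycles of
  \<open>\<L>\<close>; these two are joined by any cycle of \<open>\<F>\<close>, since it meets
  both.\<close>

lemma circuit_in_connected:
  assumes "matroid_circuit M C"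
  shows "\<exists>S. C \<subseteq> S \<and> S \<subseteq> E \<and> connected_edges G S"
  using assms unfolding circuit_iff quasi_biased_circuit_def
proof (elim disjE exE bexE conjE)
  have CE: "C \<subseteq> E" using assms ground_eq unfolding matroid_circuit_def by simp
  { assume "C \<in> \<B>"
    then show ?thesis using cycle_connected cycle_if_class CE by blast
  next
    assume "is_theta G C"
    then obtain Z1 Z2 where "is_cycle G Z1" "is_cycle G Z2" "C = Z1 \<union> Z2"
      "vertex_set G Z1 \<inter> vertex_set G Z2 \<noteq> {}" by (rule theta_cyclesE)
    then show ?thesis using connected_edges_Un[of G Z1 Z2] cycle_connected CE by blast
  next
    fix C1 C2 assume "is_tight_handcuff G C1 C2 C"
    then have h: "is_cycle G C1" "is_cycle G C2" "C = C1 \<union> C2"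
      and "vertex_set G C1 \<inter> vertex_set G C2 \<noteq> {}" unfolding is_tight_handcuff_def by auto
    then show ?thesis using connected_edges_Un[of G C1 C2] cycle_connected CE by blast
  next
    fix C1 C2 assume h: "C1 \<in> \<L>" "C2 \<in> \<L>" "C = C1 \<union> C2"
    obtain D where D: "D \<in> \<F>" using nondegenerate_F unfolding degenerate_def by blast
    have "connected_edges G (C1 \<union> D)"
      using h D by (intro connected_edges_Un cycle_connected cycle_if_class L_meets_F)
    moreover have "vertex_set G (C1 \<union> D) \<inter> vertex_set G C2 \<noteq> {}"
      using L_meets_F[OF h(2) D] unfolding vertex_set_Un by blast
    ultimately have "connected_edges G (C1 \<union> D \<union> C2)"
      by (rule connected_edges_Un[OF _ cycle_connected[OF cycle_if_class(2)[OF h(2)]]])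
    moreover have "C1 \<union> D \<union> C2 \<subseteq> E" using cycle_edges cycle_if_class h D by blast
    ultimately show ?thesis using h(3) by (intro exI[of _ "C1 \<union> D \<union> C2"]) auto
  next
    fix C1 C2 assume "is_loose_handcuff G C1 C2 C"
    then show ?thesis using loose_handcuff_connected CE by blast
  }
qed

text \<open>Otherwise no edge joins \<open>W\<close> to its complement. As circuits lie in connected
  edge sets, \<open>e\<close> would then share no circuit with an edge that is not inside
  \<open>W\<close>, although \<open>M\<close> is connected.\<close>

lemma leaving_edge:
  assumes e: "e \<in> E" "ends G e \<subseteq> W" and W: "\<not> V \<subseteq> W"
  obtains f where "f \<in> E" "ends G f \<inter> W \<noteq> {}" "\<not> ends G f \<subseteq> W"
proof (rule ccontr)
  assume "\<not> thesis"
  then have "\<not> (\<exists>f \<in> E. ends G f \<inter> W \<noteq> {} \<and> \<not> ends G f \<subseteq> W)" using that by blast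
  then have closed: "ends G f \<subseteq> W \<or> ends G f \<inter> W = {}" if "f \<in> E" for f using that by blast
  obtain f where f: "f \<in> E" "\<not> ends G f \<subseteq> W" using W unfolding vertex_set_def by blast
  have "e \<noteq> f" using e f by blast
  then obtain C where C: "matroid_circuit M C" "e \<in> C" "f \<in> C"
    using connected e f ground_eq unfolding connected_matroid_def by metis
  obtain S where S: "C \<subseteq> S" "S \<subseteq> E" "connected_edges G S" using circuit_in_connected[OF C(1)] by blast
  have "ends G e \<subseteq> vertex_set G S" "ends G f \<subseteq> vertex_set G S"
    using C S unfolding vertex_set_def by blast+
  moreover have "vertex_set G S \<subseteq> W"
  proof (rule connected_edges_closed[OF S(3)])
    show "vertex_set G S \<inter> W \<noteq> {}" using calculation(1) e ends_nonempty[OF e(1)] by blast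
  qed (use closed S(2) in blast)
  ultimately show False using f by blast
qed

text \<open>By \<open>crossing_circuit_spans_side\<close> for both sides, \<open>card C\<close> is
  the sum of the two ranks. This exceeds r(M) because there is no 1-separation, while a circuit has
  at most r(M) + 1 elements.\<close>

lemma crossing_circuit_card:
  assumes C: "matroid_circuit M C" "crossing C"
  shows "card C = Suc (matroid_rank M E)" "card (C - X) = matroid_rank M (E - X)"
proof -
  have CE: "C \<subseteq> E" "finite C" using C(1) finite_E finite_subset ground_eq unfolding matroid_circuit_def by auto
  have X: "card (C \<inter> X) = matroid_rank M X"
    using crossing_circuit_spans_side[OF unbreakable simple separation C(1)] C(2)
    unfolding crossing_def by blast
  have "C \<inter> (E - X) = C - X" "C - (E - X) = C \<inter> X" using CE by auto
  then show Y: "card (C - X) = matroid_rank M (E - X)"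
    using crossing_circuit_spans_side[OF unbreakable simple matroid_separation_compl[OF separation] C(1)] C(2) ground_eq
    unfolding crossing_def by simp
  have "card C = card (C \<inter> X) + card (C - X)"
    using card_Un_disjoint[of "C \<inter> X" "C - X"] CE by (simp add: Int_Diff_Un Int_Diff_disjoint)
  moreover have "matroid_rank M E < matroid_rank M X + matroid_rank M (E - X)"
    using connected_no_1_separation[OF connected, of X] separation ground_eq
    unfolding matroid_separation_def by auto
  moreover have "Suc (matroid_rank M C) = card C" by (rule rank_circuit[OF C(1)])
  moreover have "matroid_rank M C \<le> matroid_rank M E" by (rule rank_mono[OF CE(1)])
  ultimately show "card C = Suc (matroid_rank M E)" using X Y by linarith
qed

text \<open>\<open>f\<close> would be the only edge of \<open>C\<close> at its end outside
  \<open>W\<close>, but circuits have no pendant edges.\<close>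

lemma no_circuit_through_pendant:
  assumes f: "f \<in> E" "ends G f \<inter> W \<noteq> {}" "\<not> ends G f \<subseteq> W"
    and C: "matroid_circuit M C" "f \<in> C" "C \<subseteq> insert f I" "vertex_set G I \<subseteq> W"
  shows False
proof -
  obtain v w where v: "v \<in> ends G f" "v \<notin> W" "w \<in> ends G f" "w \<in> W" using f by blast
  have "card (ends G f) = 2" using ends_card[OF f(1)] v card_1_singletonE by (metis singletonD)
  then obtain g where "g \<in> C" "g \<noteq> f" "v \<in> ends G g"
    using no_pendantD[OF circuit_no_pendant[OF C(1)] C(2) v(1)] by blast
  then show False using C v(2) unfolding vertex_set_def by blast
qed

text \<open>Removing an element \<open>c\<close> leaves a basis of \<open>M\<close>. An edge
  \<open>f\<close> leaving the vertex set of \<open>C\<close> would form a circuit with edges of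
  this basis and be pendant in it.\<close>

lemma crossing_circuit_vertices:
  assumes C: "matroid_circuit M C" "crossing C"
  shows "vertex_set G C = V"
proof (rule ccontr)
  have CE: "C \<subseteq> E" "finite C" using C(1) finite_E finite_subset ground_eq unfolding matroid_circuit_def by auto
  assume "vertex_set G C \<noteq> V"
  then have nV: "\<not> V \<subseteq> vertex_set G C" using vertex_set_mono[OF CE(1), of G] by blast
  obtain c where c: "c \<in> C" using C(2) unfolding crossing_def by blast
  then have "c \<in> E" "ends G c \<subseteq> vertex_set G C" using CE unfolding vertex_set_def by auto
  then obtain f where f: "f \<in> E" "ends G f \<inter> vertex_set G C \<noteq> {}" "\<not> ends G f \<subseteq> vertex_set G C"
    using leaving_edge[OF _ _ nV] by metis
  have fC: "f \<notin> C" using f(3) unfolding vertex_set_def by blast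
  have i: "indep M (C - {c})" using C(1) c unfolding matroid_circuit_def by blast
  have "card (insert f (C - {c})) = Suc (card (C - {c}))" using fC CE(2) by simp
  then have "card (insert f (C - {c})) = card C" using card_Suc_Diff1[OF CE(2) c] by simp
  then have "\<not> indep M (insert f (C - {c}))"
    using crossing_circuit_card(1)[OF C] card_le_rank[of "insert f (C - {c})" E] f(1) CE by fastforce
  then obtain K where K: "matroid_circuit M K" "f \<in> K" "K \<subseteq> insert f (C - {c})"
    using exists_circuit_insert[OF i] f(1) ground_eq by metis
  have "vertex_set G (C - {c}) \<subseteq> vertex_set G C" by (rule vertex_set_mono) auto
  then show False by (rule no_circuit_through_pendant[OF f K])
qed

text \<open>An independent set with at least as many edges as vertices is enlarged by leaving edges
  until it reaches all of \<open>V\<close>. The cycle \<open>L1\<close> is a start: it is a proper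
  subset of the circuit \<open>L1 \<union> L2\<close>.\<close>

lemma card_vertices_le_rank: "card V \<le> matroid_rank M E"
proof -
  obtain L1 L2 where L: "L1 \<in> \<L>" "L2 \<in> \<L>" "vertex_disjoint G L1 L2"
    using nondegenerate_L unfolding degenerate_def by blast
  have LE: "L1 \<subseteq> E" "L2 \<subseteq> E" "L1 \<noteq> {}" "L2 \<noteq> {}"
    using L cycle_edges cycle_nonempty cycle_if_class by blast+
  have "L1 \<inter> L2 = {}" by (rule vertex_disjoint_edges_disjoint[OF finite_G L(3) LE(1)])
  then have "L1 \<subset> L1 \<union> L2" using LE by blast
  moreover have "matroid_circuit M (L1 \<union> L2)" unfolding circuit_iff quasi_biased_circuit_def using L by blast
  ultimately have L1: "indep M L1" unfolding matroid_circuit_def by blast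
  define P where "P I \<longleftrightarrow> indep M I \<and> I \<noteq> {} \<and> card (vertex_set G I) \<le> card I" for I
  have "P L1" unfolding P_def using L1 LE cycle_card[OF cycle_if_class(2)[OF L(1)]] by simp
  moreover have "card I \<le> card E" if "P I" for I
    using that indep_subset_ground ground_eq finite_E card_mono unfolding P_def by metis
  ultimately obtain I where I: "P I" and max: "\<And>J. P J \<Longrightarrow> card J \<le> card I"
    using ex_has_greatest_nat[of P L1 card "Suc (card E)"] by (metis less_Suc_eq_le)
  have i: "indep M I" "I \<noteq> {}" "card (vertex_set G I) \<le> card I" using I unfolding P_def by auto
  have IE: "I \<subseteq> E" "finite I" using i(1) indep_subset_ground ground_eq finite_indep by auto
  have "V \<subseteq> vertex_set G I"
  proof (rule ccontr)
    assume nV: "\<not> V \<subseteq> vertex_set G I"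
    obtain e where "e \<in> I" using i(2) by blast
    then have "e \<in> E" "ends G e \<subseteq> vertex_set G I" using IE unfolding vertex_set_def by auto
    then obtain f where f: "f \<in> E" "ends G f \<inter> vertex_set G I \<noteq> {}" "\<not> ends G f \<subseteq> vertex_set G I"
      using leaving_edge[OF _ _ nV] by metis
    have fI: "f \<notin> I" using f(3) unfolding vertex_set_def by blast
    have "indep M (insert f I)"
    proof (rule ccontr)
      assume "\<not> indep M (insert f I)"
      then obtain K where "matroid_circuit M K" "f \<in> K" "K \<subseteq> insert f I"
        using exists_circuit_insert[OF i(1)] f(1) ground_eq by metis
      then show False by (rule no_circuit_through_pendant[OF f _ _ _ order_refl])
    qed
    \<comment> \<open>\<open>f\<close> already has an end among the vertices of \<open>I\<close>, so
      it brings at most one new vertex.\<close>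
    moreover have "card (vertex_set G (insert f I)) \<le> card (insert f I)"
    proof -
      have finV: "finite (vertex_set G I)" using finite_subset[OF vertex_set_mono[OF IE(1)] finite_V] .
      have fe: "finite (ends G f)" "card (ends G f) \<le> 2" using ends_card[OF f(1)] card_ge_0_finite by force+
      have "vertex_set G (insert f I) = vertex_set G I \<union> ends G f" unfolding vertex_set_def by auto
      moreover have "card (vertex_set G I \<union> ends G f) + card (vertex_set G I \<inter> ends G f)
          = card (vertex_set G I) + card (ends G f)" using card_Un_Int[OF finV fe(1)] by simp
      moreover have "0 < card (vertex_set G I \<inter> ends G f)"
        using f(2) finV by (simp add: card_gt_0_iff inf_commute)
      ultimately show ?thesis using i(3) fe(2) fI IE(2) by simp
    qed
    ultimately have "P (insert f I)" unfolding P_def by simp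
    then show False using max[of "insert f I"] fI IE(2) by simp
  qed
  then have "card V \<le> card (vertex_set G I)"
    using finite_subset[OF vertex_set_mono[OF IE(1)] finite_V] by (intro card_mono)
  also have "\<dots> \<le> card I" by (rule i(3))
  also have "\<dots> \<le> matroid_rank M E" by (rule card_le_rank[OF i(1) IE(1)])
  finally show ?thesis .
qed

text \<open>A cycle has as many edges as vertices, hence at most r(M), while a crossing circuit has
  r(M) + 1.\<close>

lemma balanced_not_crossing:
  assumes "C \<in> \<B>" shows "\<not> crossing C"
proof
  assume c: "crossing C"
  have "matroid_circuit M C" unfolding circuit_iff quasi_biased_circuit_def using assms by blast
  then have "card C = Suc (matroid_rank M E)" using c crossing_circuit_card by blast
  moreover have "card C = card (vertex_set G C)" using assms cycle_card cycle_if_class by blast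
  moreover have "card (vertex_set G C) \<le> card V"
    using assms cycle_edges cycle_if_class by (intro card_mono[OF finite_V] vertex_set_mono) blast
  ultimately show False using card_vertices_le_rank by linarith
qed

text \<open>Two disjoint cycles have at most \<open>card V\<close> edges together, again fewer than
  a crossing circuit.\<close>

lemma L_pair_not_crossing:
  assumes "C \<in> \<L>" "D \<in> \<L>" "vertex_disjoint G C D" shows "\<not> crossing (C \<union> D)"
proof
  assume c: "crossing (C \<union> D)"
  have "matroid_circuit M (C \<union> D)" unfolding circuit_iff quasi_biased_circuit_def using assms by blast
  then have "card (C \<union> D) = Suc (matroid_rank M E)" using c crossing_circuit_card by blast
  moreover have "card (C \<union> D) \<le> card C + card D" by (rule card_Un_le)
  moreover have "card C = card (vertex_set G C)" "card D = card (vertex_set G D)"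
    using assms cycle_card cycle_if_class by blast+
  moreover have sub: "vertex_set G C \<subseteq> V" "vertex_set G D \<subseteq> V"
    using assms cycle_edges cycle_if_class by (intro vertex_set_mono; blast)+
  have "card (vertex_set G C) + card (vertex_set G D) = card (vertex_set G C \<union> vertex_set G D)"
    using card_Un_disjoint[of "vertex_set G C" "vertex_set G D"] assms(3) sub finite_V finite_subset by metis
  moreover have "card (vertex_set G C \<union> vertex_set G D) \<le> card V"
    using sub by (intro card_mono[OF finite_V]) auto
  ultimately show False using card_vertices_le_rank by linarith
qed

text \<open>\<open>Z\<close> and the ear form a theta without cycles of \<open>\<B>\<close>, hence a
  circuit, and it crosses because of \<open>f\<close>. Both conclusions are then properties of
  crossing circuits.\<close>

lemma crossing_theta:
  assumes Z: "is_cycle G Z" "Z \<notin> \<B>" "Z \<subseteq> X"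
    and p: "is_path G ws fs" "set ws \<inter> vertex_set G Z = {hd ws, last ws}"
    and f: "f \<in> set fs" "f \<notin> X"
  shows "V = vertex_set G Z \<union> set ws" "card (set fs - X) = matroid_rank M (E - X)"
proof -
  have ne: "fs \<noteq> []" using f by auto
  \<comment> \<open>An edge of \<open>Z\<close> on the path would join its ends and so be the whole
    path, leaving no room for \<open>f\<close>.\<close>
  have disj: "set fs \<inter> Z = {}"
  proof (rule ccontr)
    assume "set fs \<inter> Z \<noteq> {}"
    then obtain e where e: "e \<in> set fs" "e \<in> Z" by blast
    have "ends G e \<subseteq> {hd ws, last ws}"
      using path_ends_in_set[OF p(1) e(1)] ends_subset_vertex_set[OF e(2), of G] p(2) by blast
    then have "fs = [e]" by (rule path_edge_between_ends[OF p(1) e(1)])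
    then show False using f e Z(3) by auto
  qed
  have theta: "is_theta G (Z \<union> set fs)" by (rule theta_of_ear[OF Z(1) p(1) ne p(2) disj])
  \<comment> \<open>A cycle in the theta that avoids the ear is \<open>Z\<close>. Any other contains
    the whole ear and thus \<open>f\<close>; if it is in \<open>\<B>\<close>, it does not cross, so
    it lies outside \<open>X\<close> and within the ear, but a path contains no cycle.\<close>
  have "\<not> C \<subseteq> Z \<union> set fs" if C: "C \<in> \<B>" for C
  proof
    assume sub: "C \<subseteq> Z \<union> set fs"
    have cyc: "is_cycle G C" using C cycle_if_class by blast
    note np = cycle_no_pendant[OF cyc]
    show False
    proof (cases "C \<inter> set fs = {}")
      case True
      then have "C = Z" using sub by (intro cycle_subset_eq[OF cyc Z(1)]) blast
      then show False using C Z by simp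
    next
      case False
      have int: "ws ! k \<notin> vertex_set G Z" if "0 < k" "k < length fs" for k
      proof
        assume "ws ! k \<in> vertex_set G Z"
        then have "ws ! k \<in> {hd ws, last ws}" using p(2) path_set[OF p(1)] that by auto
        then show False using that path_hd[OF p(1)] path_last[OF p(1)]
            path_nth_eq_iff[OF p(1), of k 0] path_nth_eq_iff[OF p(1), of k "length fs"] by auto
      qed
      have "set fs \<subseteq> C" by (rule no_pendant_path_all[OF p(1) np sub int False])
      then have "C \<inter> X = {}" using balanced_not_crossing[OF C] f unfolding crossing_def by blast
      then have "C \<subseteq> set fs" using sub Z(3) by blast
      then show False using no_pendant_path_empty[OF p(1) np] cycle_nonempty[OF cyc] by blast
    qed
  qed
  then have c: "matroid_circuit M (Z \<union> set fs)"
    unfolding circuit_iff quasi_biased_circuit_def using theta by blast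
  have x: "crossing (Z \<union> set fs)"
    unfolding crossing_def using f cycle_nonempty[OF Z(1)] Z(3) by blast
  show "V = vertex_set G Z \<union> set ws"
    using crossing_circuit_vertices[OF c x] path_vertex_set[OF p(1) ne] by (simp add: vertex_set_Un)
  have "(Z \<union> set fs) - X = set fs - X" using Z(3) by blast
  then show "card (set fs - X) = matroid_rank M (E - X)" using crossing_circuit_card(2)[OF c x] by simp
qed

lemma crossing_tight_handcuff:
  assumes Z: "is_cycle G Z" "Z \<notin> \<B>" "Z \<subseteq> X" and D: "is_cycle G D" "D \<notin> \<B>" "\<not> D \<subseteq> X"
    and v: "vertex_set G Z \<inter> vertex_set G D = {v}"
  shows "V = vertex_set G Z \<union> vertex_set G D" "card (D - X) = matroid_rank M (E - X)"
proof -
  \<comment> \<open>A common edge has no end besides \<open>v\<close>, so it is a loop and forms all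
    of \<open>D\<close>, although \<open>D\<close> is not inside \<open>X\<close>.\<close>
  have "Z \<inter> D = {}"
  proof (rule ccontr)
    assume "Z \<inter> D \<noteq> {}"
    then obtain e where e: "e \<in> Z" "e \<in> D" by blast
    have "ends G e \<subseteq> {v}" using e v unfolding vertex_set_def by blast
    then have "card (ends G e) \<le> card {v}" by (intro card_mono) auto
    then have "D = {e}" by (intro cycle_loop[OF D(1) e(2)]) simp
    then show False using e Z(3) D(3) by blast
  qed
  then have "is_tight_handcuff G Z D (Z \<union> D)" unfolding is_tight_handcuff_def using Z D v by simp
  then have c: "matroid_circuit M (Z \<union> D)"
    unfolding circuit_iff quasi_biased_circuit_def using Z D by blast
  have x: "crossing (Z \<union> D)" unfolding crossing_def using D cycle_nonempty[OF Z(1)] Z(3) by blast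
  show "V = vertex_set G Z \<union> vertex_set G D"
    using crossing_circuit_vertices[OF c x] by (simp add: vertex_set_Un)
  have "(Z \<union> D) - X = D - X" using Z(3) by blast
  then show "card (D - X) = matroid_rank M (E - X)" using crossing_circuit_card(2)[OF c x] by simp
qed

text \<open>\<open>i\<close> and \<open>j\<close> are the extreme indices at which the opened cycle
  meets \<open>Z\<close>. For \<open>i < j\<close>, the arc outside them carries \<open>f\<close>
  and is an ear of \<open>Z\<close>, giving a crossing theta; for \<open>i = j\<close>,
  \<open>Z\<close> and \<open>D\<close> form a tight handcuff.\<close>

lemma crossing_cycle_cover:
  assumes r: "cycle_rep G D f vs es" and f: "f \<notin> X" and D: "crossing D"
    and Z: "is_cycle G Z" "Z \<notin> \<B>" "Z \<subseteq> X" and meet: "vertex_set G Z \<inter> vertex_set G D \<noteq> {}"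
  obtains i j where "i \<le> j" "j \<le> length es" "vs ! i \<in> vertex_set G Z" "vs ! j \<in> vertex_set G Z"
    "\<And>k. k \<le> length es \<Longrightarrow> vs ! k \<in> vertex_set G Z \<Longrightarrow> i \<le> k \<and> k \<le> j"
    "V = vertex_set G Z \<union> (!) vs ` ({..i} \<union> {j..length es})"
    "matroid_rank M (E - X) \<le> card (D - X)"
proof -
  note p = cycle_repD(1)[OF r]
  have cyc: "is_cycle G D" using r by (rule cycle_rep_is_cycle)
  have finD: "finite D" using cycle_edges[OF cyc] finite_E finite_subset by blast
  define N where "N = {k. k \<le> length es \<and> vs ! k \<in> vertex_set G Z}"
  define i j where "i = Min N" and "j = Max N"
  have fN: "finite N" unfolding N_def by simp
  have neN: "N \<noteq> {}" using meet cycle_rep_vertex_set[OF r] path_set[OF p] unfolding N_def by auto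
  have iN: "i \<in> N" "j \<in> N" unfolding i_def j_def using fN neN by auto
  then have ij: "i \<le> j" "j \<le> length es" "vs ! i \<in> vertex_set G Z" "vs ! j \<in> vertex_set G Z"
    unfolding i_def using fN by (auto simp: N_def)
  have bound: "i \<le> k \<and> k \<le> j" if "k \<le> length es" "vs ! k \<in> vertex_set G Z" for k
    unfolding i_def j_def using fN that by (auto simp: N_def)
  have "V = vertex_set G Z \<union> (!) vs ` ({..i} \<union> {j..length es}) \<and> matroid_rank M (E - X) \<le> card (D - X)"
  proof (cases "i = j")
    case True
    have "vertex_set G Z \<inter> vertex_set G D \<subseteq> {vs ! i}"
    proof
      fix v assume v: "v \<in> vertex_set G Z \<inter> vertex_set G D"
      then obtain k where k: "k \<le> length es" "v = vs ! k"
        using cycle_rep_vertex_set[OF r] path_set[OF p] by auto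
      then have "k = i" using bound[of k] v True by simp
      then show "v \<in> {vs ! i}" using k by simp
    qed
    then have v: "vertex_set G Z \<inter> vertex_set G D = {vs ! i}" using meet by blast
    have "D \<notin> \<B>" using D balanced_not_crossing by blast
    moreover have "\<not> D \<subseteq> X" using f cycle_repD(6)[OF r] by blast
    ultimately have t: "V = vertex_set G Z \<union> vertex_set G D" "card (D - X) = matroid_rank M (E - X)"
      using crossing_tight_handcuff[OF Z cyc _ _ v] by auto
    have "{..i} \<union> {j..length es} = {..length es}" using True ij by auto
    then show ?thesis using t cycle_rep_vertex_set[OF r] path_set[OF p] by simp
  next
    case False
    then have lt: "i < j" using ij by simp
    obtain ws fs where o: "is_path G ws fs" "hd ws = vs ! i" "last ws = vs ! j"
      "set ws = (!) vs ` ({..i} \<union> {j..length es})"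
      "set fs = insert f ((!) es ` ({..<i} \<union> {j..<length es}))"
      using path_outer[OF r lt ij(2)] .
    have "set ws \<inter> vertex_set G Z \<subseteq> {vs ! i, vs ! j}"
    proof
      fix v assume v: "v \<in> set ws \<inter> vertex_set G Z"
      then obtain k where k: "k \<in> {..i} \<union> {j..length es}" "v = vs ! k" using o(4) by (metis IntD1 imageE)
      then have "k \<le> length es" using ij by auto
      then have "i \<le> k \<and> k \<le> j" using bound[of k] v k by simp
      then have "k = i \<or> k = j" using k by auto
      then show "v \<in> {vs ! i, vs ! j}" using k by auto
    qed
    moreover have "vs ! i \<in> set ws" "vs ! j \<in> set ws" using o(4) ij by auto
    ultimately have ear: "set ws \<inter> vertex_set G Z = {hd ws, last ws}" using o(2,3) ij by auto
    have ff: "f \<in> set fs" using o(5) by simp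
    note t = crossing_theta[OF Z o(1) ear ff f]
    have "set fs \<subseteq> D" using o(5) cycle_repD(5)[OF r] ij by auto
    then have "card (set fs - X) \<le> card (D - X)" using finD by (intro card_mono) auto
    then show ?thesis using t o(4) by simp
  qed
  then show ?thesis using that[OF ij bound] by blast
qed

section \<open>Exchange of the sides, and crossing cycles when \<open>X\<close> contains two
  disjoint cycles of \<open>\<L>\<close>\<close>

lemma swap_sides: "quasi_biased_2_separation M G \<B> \<L> \<F> (E - X)"
  using quasi_biased nondegenerate_L nondegenerate_F quasi_biased_matroid simple unbreakable
    matroid_separation_compl[OF separation] ground_eq
  by unfold_locales auto

text \<open>A crossing cycle misses no cycle of \<open>\<L>\<close> inside \<open>X\<close>, so \<open>crossing_cycle_cover\<close> applies to
  two disjoint ones; comparing both covers leaves no vertex outside the cycle.\<close>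

lemma crossing_cycle_hamiltonian:
  assumes L: "L1 \<in> \<L>" "L2 \<in> \<L>" "vertex_disjoint G L1 L2" "L1 \<subseteq> X" "L2 \<subseteq> X"
    and D: "is_cycle G D" "crossing D"
  shows "vertex_set G D = V" "matroid_rank M (E - X) \<le> card (D - X)"
proof -
  obtain f where f: "f \<in> D" "f \<notin> X" using D(2) unfolding crossing_def by blast
  obtain vs es where r: "cycle_rep G D f vs es" using cycle_rep_at[OF D(1) f(1)] .
  have cov: "V \<subseteq> vertex_set G Z \<union> vertex_set G D \<and> matroid_rank M (E - X) \<le> card (D - X)"
    if Z: "Z \<in> \<L>" "Z \<subseteq> X" for Z
  proof -
    have "vertex_set G Z \<inter> vertex_set G D \<noteq> {}"
    proof (cases "D \<in> \<L>")
      case True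
      have "crossing (Z \<union> D)" using D(2) unfolding crossing_def by blast
      then show ?thesis using L_pair_not_crossing[OF Z(1) True] by blast
    next
      case False
      then have "D \<in> \<F>" using unbalanced_cycle[OF D(1)] D(2) balanced_not_crossing by blast
      then show ?thesis by (rule L_meets_F[OF Z(1)])
    qed
    then obtain i j where ij: "j \<le> length es" "i \<le> j"
      "V = vertex_set G Z \<union> (!) vs ` ({..i} \<union> {j..length es})"
      "matroid_rank M (E - X) \<le> card (D - X)"
      using crossing_cycle_cover[OF r f(2) D(2) cycle_if_class(2)[OF Z(1)] class_disjoint(1)[OF Z(1)] Z(2)]
      by metis
    have "(!) vs ` ({..i} \<union> {j..length es}) \<subseteq> (!) vs ` {..length es}" using ij by (intro image_mono) auto
    then have "(!) vs ` ({..i} \<union> {j..length es}) \<subseteq> vertex_set G D"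
      using cycle_rep_vertex_set[OF r] path_set[OF cycle_repD(1)[OF r]] by simp
    then show ?thesis using ij(3,4) by blast
  qed
  have "vertex_set G D \<subseteq> V" by (intro vertex_set_mono cycle_edges D(1))
  moreover have "V \<subseteq> vertex_set G D"
    using cov[OF L(1,4)] cov[OF L(2,5)] L(3) by blast
  ultimately show "vertex_set G D = V" by blast
  show "matroid_rank M (E - X) \<le> card (D - X)" using cov[OF L(1,4)] by blast
qed

text \<open>As \<open>D\<close> passes through all vertices, those of \<open>Z\<close> have indices
  on the opened cycle. Between the extreme indices \<open>i\<close> and \<open>j\<close>, the cover
  of \<open>V\<close> leaves each vertex no choice but to lie on \<open>Z\<close>.\<close>

lemma crossing_cycle_interval:
  assumes r: "cycle_rep G D f vs es" and f: "f \<notin> X" and D: "crossing D" "vertex_set G D = V"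
    and Z: "is_cycle G Z" "Z \<notin> \<B>" "Z \<subseteq> X"
  shows "\<exists>i j. i \<le> j \<and> j \<le> length es \<and> vertex_set G Z = (!) vs ` {i..j}"
proof -
  note p = cycle_repD(1)[OF r]
  have VD: "V = (!) vs ` {..length es}" using D(2) cycle_rep_vertex_set[OF r] path_set[OF p] by simp
  have ZV: "vertex_set G Z \<subseteq> V" by (intro vertex_set_mono cycle_edges Z(1))
  have "vertex_set G Z \<noteq> {}"
    using cycle_rep_exists[OF Z(1)] cycle_rep_vertex_set path_hd_in cycle_repD(1) by (metis empty_iff)
  then have "vertex_set G Z \<inter> vertex_set G D \<noteq> {}" using ZV D(2) by blast
  then obtain i j where ij: "i \<le> j" "j \<le> length es" "vs ! i \<in> vertex_set G Z" "vs ! j \<in> vertex_set G Z"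
    and bound: "\<And>k. k \<le> length es \<Longrightarrow> vs ! k \<in> vertex_set G Z \<Longrightarrow> i \<le> k \<and> k \<le> j"
    and cov: "V = vertex_set G Z \<union> (!) vs ` ({..i} \<union> {j..length es})"
    using crossing_cycle_cover[OF r f D(1) Z] by metis
  have "vertex_set G Z \<subseteq> (!) vs ` {i..j}"
  proof
    fix v assume v: "v \<in> vertex_set G Z"
    then obtain k where "k \<le> length es" "v = vs ! k" using ZV VD by auto
    then show "v \<in> (!) vs ` {i..j}" using bound[of k] v by auto
  qed
  moreover have "vs ! k \<in> vertex_set G Z" if k: "i \<le> k" "k \<le> j" for k
  proof (rule ccontr)
    assume n: "vs ! k \<notin> vertex_set G Z"
    have "vs ! k \<in> V" using VD k ij(2) by auto
    then obtain m where m: "m \<in> {..i} \<union> {j..length es}" "vs ! k = vs ! m"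
      using cov n by (metis UnE imageE)
    then have "k = m" using path_nth_eq_iff[OF p, of k m] k ij by auto
    then have "k = i \<or> k = j" using m k by auto
    then show False using n ij by auto
  qed
  ultimately have "vertex_set G Z = (!) vs ` {i..j}" by auto
  then show ?thesis using ij by blast
qed

text \<open>On the opened cycle all four vertex sets are intervals. \<open>F1\<close> and
  \<open>F2\<close> each meet both of the disjoint intervals of \<open>L1\<close> and
  \<open>L2\<close>, so both contain the last index of the earlier one, against their own
  disjointness.\<close>

lemma no_crossing_cycle_if_all_inside:
  assumes L: "L1 \<in> \<L>" "L2 \<in> \<L>" "vertex_disjoint G L1 L2" "L1 \<subseteq> X" "L2 \<subseteq> X"
    and F: "F1 \<in> \<F>" "F2 \<in> \<F>" "vertex_disjoint G F1 F2" "F1 \<subseteq> X" "F2 \<subseteq> X"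
    and D: "is_cycle G D"
  shows "\<not> crossing D"
proof
  assume x: "crossing D"
  obtain f where f: "f \<in> D" "f \<notin> X" using x unfolding crossing_def by blast
  obtain vs es where r: "cycle_rep G D f vs es" using cycle_rep_at[OF D(1) f(1)] .
  note p = cycle_repD(1)[OF r]
  note I = crossing_cycle_interval[OF r f(2) x crossing_cycle_hamiltonian(1)[OF L D x]]
  obtain a1 b1 where 1: "a1 \<le> b1" "b1 \<le> length es" "vertex_set G L1 = (!) vs ` {a1..b1}"
    using I[OF cycle_if_class(2) class_disjoint(1)] L by blast
  obtain a2 b2 where 2: "a2 \<le> b2" "b2 \<le> length es" "vertex_set G L2 = (!) vs ` {a2..b2}"
    using I[OF cycle_if_class(2) class_disjoint(1)] L by blast
  obtain c1 d1 where 3: "c1 \<le> d1" "d1 \<le> length es" "vertex_set G F1 = (!) vs ` {c1..d1}"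
    using I[OF cycle_if_class(3) class_disjoint(2)] F by blast
  obtain c2 d2 where 4: "c2 \<le> d2" "d2 \<le> length es" "vertex_set G F2 = (!) vs ` {c2..d2}"
    using I[OF cycle_if_class(3) class_disjoint(2)] F by blast
  have meet: "a \<le> d \<and> c \<le> b" if bd: "b \<le> length es" "d \<le> length es"
    "(!) vs ` {a..b} \<inter> (!) vs ` {c..d} \<noteq> {}" for a b c d
  proof -
    obtain k m where "k \<in> {a..b}" "m \<in> {c..d}" "vs ! k = vs ! m" using bd(3) by blast
    then show ?thesis using path_nth_eq_iff[OF p, of k m] bd(1,2) by auto
  qed
  have apart: "b < c \<or> d < a" if "a \<le> b" "c \<le> d"
    "(!) vs ` {a..b} \<inter> (!) vs ` {c..d} = {}" for a b c d
  proof (rule ccontr)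
    assume "\<not> (b < c \<or> d < a)"
    \<comment> \<open>Overlapping intervals share the larger of their left ends.\<close>
    then have "max a c \<in> {a..b}" "max a c \<in> {c..d}" using that(1,2) by auto
    from this[THEN imageI[of _ _ "(!) vs"]] show False using that(3) by (metis IntI empty_iff)
  qed
  have "a1 \<le> d1 \<and> c1 \<le> b1" by (rule meet[OF 1(2) 3(2) L_meets_F[OF L(1) F(1), unfolded 1(3) 3(3)]])
  moreover have "a1 \<le> d2 \<and> c2 \<le> b1" by (rule meet[OF 1(2) 4(2) L_meets_F[OF L(1) F(2), unfolded 1(3) 4(3)]])
  moreover have "a2 \<le> d1 \<and> c1 \<le> b2" by (rule meet[OF 2(2) 3(2) L_meets_F[OF L(2) F(1), unfolded 2(3) 3(3)]])
  moreover have "a2 \<le> d2 \<and> c2 \<le> b2" by (rule meet[OF 2(2) 4(2) L_meets_F[OF L(2) F(2), unfolded 2(3) 4(3)]])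
  moreover have "b1 < a2 \<or> b2 < a1" by (rule apart[OF 1(1) 2(1) L(3)[unfolded 1(3) 2(3)]])
  moreover have "d1 < c2 \<or> d2 < c1" by (rule apart[OF 3(1) 4(1) F(3)[unfolded 3(3) 4(3)]])
  ultimately show False by linarith
qed

text \<open>The path is trimmed around \<open>f\<close> to an ear of \<open>S\<close> and closed by
  a nonempty path within \<open>S\<close>, whose edges lie in \<open>X\<close>.\<close>

lemma crossing_cycle_of_path:
  assumes S: "connected_edges G S" "S \<subseteq> X"
    and p: "is_path G vs es" "hd vs \<in> vertex_set G S" "last vs \<in> vertex_set G S"
    and f: "f \<in> set es" "f \<notin> X"
  obtains D where "is_cycle G D" "crossing D"
proof -
  obtain ws fs where o: "is_path G ws fs" "f \<in> set fs" "set fs \<subseteq> set es"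
    "set ws \<inter> vertex_set G S = {hd ws, last ws}" using path_ear[OF p f(1)] .
  have "set fs \<inter> S = {}"
  proof (rule ccontr)
    assume "set fs \<inter> S \<noteq> {}"
    then obtain e where e: "e \<in> set fs" "e \<in> S" by blast
    have "ends G e \<subseteq> {hd ws, last ws}"
      using path_ends_in_set[OF o(1) e(1)] ends_subset_vertex_set[OF e(2), of G] o(4) by blast
    then have "fs = [e]" by (rule path_edge_between_ends[OF o(1) e(1)])
    then show False using f(2) o(2) e(2) S(2) by auto
  qed
  moreover have "S \<subseteq> E" using S(2) X_subset by blast
  moreover have "fs \<noteq> []" using o(2) by auto
  ultimately obtain us gs where g: "is_path G us gs" "set gs \<subseteq> S" "gs \<noteq> []" "is_cycle G (set gs \<union> set fs)"
    using cycle_of_ear[OF S(1) _ finite_G o(1) _ o(4)] by metis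
  have "crossing (set gs \<union> set fs)"
  proof -
    have "hd gs \<in> X" using g(2,3) S(2) hd_in_set by blast
    then show ?thesis unfolding crossing_def using hd_in_set[OF g(3)] o(2) f(2) by blast
  qed
  then show ?thesis using that[OF g(4)] by blast
qed

text \<open>Connectedness of \<open>M\<close> gives a circuit through an edge of \<open>L1\<close>
  and an edge \<open>f\<close> outside \<open>X\<close>; the types of circuit are examined in turn.
  \<open>S\<close> is a connected edge set inside \<open>X\<close> through which arcs with edges
  outside \<open>X\<close> can be closed.\<close>

lemma crossing_cycle_exists:
  assumes L: "L1 \<in> \<L>" "L2 \<in> \<L>" "vertex_disjoint G L1 L2" "L1 \<subseteq> X" "L2 \<subseteq> X"
    and F: "F1 \<in> \<F>" "F2 \<in> \<F>" "vertex_disjoint G F1 F2" "F1 \<subseteq> X" "F2 \<subseteq> X"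
  obtains D where "is_cycle G D" "crossing D"
proof -
  have conn: "connected_edges G C" if "C \<in> \<L> \<or> C \<in> \<F>" for C
    using that cycle_connected cycle_if_class by blast
  define S where "S = L1 \<union> F1 \<union> L2 \<union> F2"
  have "connected_edges G (L1 \<union> F1)"
    by (rule connected_edges_Un) (use L F conn L_meets_F in auto)
  then have "connected_edges G (L1 \<union> F1 \<union> L2)"
    by (rule connected_edges_Un) (use L F conn L_meets_F[OF L(2) F(1)] in \<open>auto simp: vertex_set_Un\<close>)
  then have "connected_edges G S" unfolding S_def
    by (rule connected_edges_Un) (use L F conn L_meets_F[OF L(1) F(2)] in \<open>auto simp: vertex_set_Un\<close>)
  moreover have "S \<subseteq> X" unfolding S_def using L F by blast
  ultimately have S: "connected_edges G S" "S \<subseteq> X" by auto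
  have SV: "vertex_set G L1 \<subseteq> vertex_set G S" "vertex_set G L2 \<subseteq> vertex_set G S"
    "vertex_set G F1 \<subseteq> vertex_set G S" "vertex_set G F2 \<subseteq> vertex_set G S"
    unfolding S_def by (auto intro!: vertex_set_mono)
  \<comment> \<open>If \<open>Z\<close> does not cross, it lies outside \<open>X\<close>. Whether it
    is in \<open>\<L>\<close> or in \<open>\<F>\<close>, it meets both members of the disjoint pair
    of the other class, hence \<open>S\<close> in two vertices; a path in \<open>Z\<close> between
    them is then closed through \<open>S\<close>.\<close>
  have via: "\<exists>D. is_cycle G D \<and> crossing D" if Z: "is_cycle G Z" "Z \<notin> \<B>" "\<not> Z \<subseteq> X" for Z
  proof (cases "crossing Z")
    case False
    then have ZX: "Z \<inter> X = {}" using Z(3) unfolding crossing_def by blast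
    have "\<exists>u v. u \<in> vertex_set G Z \<and> v \<in> vertex_set G Z \<and> u \<in> vertex_set G S \<and> v \<in> vertex_set G S \<and> u \<noteq> v"
    proof (cases "Z \<in> \<L>")
      case True
      then obtain u v where "u \<in> vertex_set G Z" "u \<in> vertex_set G F1" "v \<in> vertex_set G Z" "v \<in> vertex_set G F2"
        using L_meets_F[OF True F(1)] L_meets_F[OF True F(2)] by blast
      then show ?thesis using SV F(3) by blast
    next
      case False
      then have Z': "Z \<in> \<F>" using unbalanced_cycle Z by blast
      then obtain u v where "u \<in> vertex_set G Z" "u \<in> vertex_set G L1" "v \<in> vertex_set G Z" "v \<in> vertex_set G L2"
        using L_meets_F[OF L(1) Z'] L_meets_F[OF L(2) Z'] by blast
      then show ?thesis using SV L(3) by blast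
    qed
    then obtain u v where uv: "u \<in> vertex_set G Z" "v \<in> vertex_set G Z"
      "u \<in> vertex_set G S" "v \<in> vertex_set G S" "u \<noteq> v" by blast
    obtain vs es where p: "is_path G vs es" "set es \<subseteq> Z" "hd vs = u" "last vs = v"
      using connected_edges_path[OF cycle_connected[OF Z(1)] cycle_edges[OF Z(1)] finite_G uv(1,2)] .
    have "es \<noteq> []" using path_hd_eq_last[OF p(1)] p(3,4) uv(5) by simp
    then have f: "hd es \<in> set es" by simp
    then have "hd es \<notin> X" using p(2) ZX by blast
    then show ?thesis using crossing_cycle_of_path[OF S p(1) _ _ f] p(3,4) uv(3,4) by metis
  qed (use Z in blast)
  obtain e where e: "e \<in> L1" using cycle_nonempty cycle_if_class L(1) by blast
  have "E - X \<noteq> {}"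
    using separation ground_eq unfolding matroid_separation_def by (metis card.empty not_numeral_le_zero)
  then obtain f where f: "f \<in> E" "f \<notin> X" by blast
  have "e \<noteq> f" "e \<in> E" using e f L(4) X_subset by auto
  then obtain C where C: "matroid_circuit M C" "e \<in> C" "f \<in> C"
    using connected f(1) ground_eq unfolding connected_matroid_def by metis
  have x: "crossing C" unfolding crossing_def using C e f L(4) by blast
  have "\<exists>D. is_cycle G D \<and> crossing D"
    using C(1) unfolding circuit_iff quasi_biased_circuit_def
  proof (elim disjE exE bexE conjE)
    assume "C \<in> \<B>"
    then show ?thesis using x balanced_not_crossing by blast
  next
    assume t: "is_theta G C" and nB: "\<not> (\<exists>D \<in> \<B>. D \<subseteq> C)"
    obtain Z1 Z2 where Z: "is_cycle G Z1" "is_cycle G Z2" "C = Z1 \<union> Z2" using t by (rule theta_cyclesE)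
    then have "Z1 \<notin> \<B>" "Z2 \<notin> \<B>" "\<not> Z1 \<subseteq> X \<or> \<not> Z2 \<subseteq> X" using nB C f by auto
    then show ?thesis using via Z by blast
  next
    fix C1 C2 assume t: "is_tight_handcuff G C1 C2 C" and nB: "C1 \<notin> \<B>" "C2 \<notin> \<B>"
    then have "is_cycle G C1" "is_cycle G C2" "C = C1 \<union> C2" unfolding is_tight_handcuff_def by auto
    then show ?thesis using via nB C f by blast
  next
    fix C1 C2 assume "C1 \<in> \<L>" "C2 \<in> \<L>" "vertex_disjoint G C1 C2" "C = C1 \<union> C2"
    then show ?thesis using x L_pair_not_crossing by blast
  next
    fix C1 C2 assume Cs: "C1 \<in> \<F>" "C2 \<in> \<F>" and l: "is_loose_handcuff G C1 C2 C"
    have cyc: "is_cycle G C1" "is_cycle G C2" "C1 \<notin> \<B>" "C2 \<notin> \<B>" using Cs cycle_if_class class_disjoint by auto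
    obtain vs es where p: "is_path G vs es" "set vs \<inter> vertex_set G C1 = {hd vs}"
      "set vs \<inter> vertex_set G C2 = {last vs}" "C = C1 \<union> C2 \<union> set es" "es \<noteq> []"
      using loose_handcuff_path[OF l] .
    show ?thesis
    proof (cases "C1 \<subseteq> X \<and> C2 \<subseteq> X")
      case False
      then show ?thesis using via cyc by blast
    next
      case True
      \<comment> \<open>Now \<open>f\<close> must lie on the connecting path, and \<open>L1\<close>
        joins the two cycles to a connected set inside \<open>X\<close>.\<close>
      have m: "vertex_set G C1 \<inter> vertex_set G L1 \<noteq> {}" "vertex_set G L1 \<inter> vertex_set G C2 \<noteq> {}"
        using L_meets_F[OF L(1) Cs(1)] L_meets_F[OF L(1) Cs(2)] by blast+
      have "connected_edges G (C1 \<union> L1)"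
        by (rule connected_edges_Un[OF cycle_connected[OF cyc(1)] _ m(1)]) (use conn L in blast)
      then have "connected_edges G (C1 \<union> L1 \<union> C2)"
        by (rule connected_edges_Un[OF _ cycle_connected[OF cyc(2)]]) (use m(2) in \<open>auto simp: vertex_set_Un\<close>)
      moreover have "C1 \<union> L1 \<union> C2 \<subseteq> X" using True L(4) by blast
      moreover have "hd vs \<in> vertex_set G (C1 \<union> L1 \<union> C2)" "last vs \<in> vertex_set G (C1 \<union> L1 \<union> C2)"
        using p(2,3) unfolding vertex_set_Un by blast+
      moreover have "f \<in> set es" using True p(4) C f by blast
      ultimately show ?thesis using crossing_cycle_of_path[OF _ _ p(1)] f(2) by metis
    qed
  qed
  then show ?thesis using that by blast
qed

text \<open>The pair is a proper subset of a loose handcuff, whose connecting path is cut out of a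
  cycle of \<open>\<L>\<close>, since that cycle meets both \<open>F1\<close> and
  \<open>F2\<close>.\<close>

lemma disjoint_F_pair_indep:
  assumes F: "F1 \<in> \<F>" "F2 \<in> \<F>" "vertex_disjoint G F1 F2"
  shows "indep M (F1 \<union> F2)"
proof -
  obtain L where L: "L \<in> \<L>" using nondegenerate_L unfolding degenerate_def by blast
  have cyc: "is_cycle G L" "is_cycle G F1" "is_cycle G F2" using L F cycle_if_class by auto
  obtain u v where uv: "u \<in> vertex_set G L" "u \<in> vertex_set G F1" "v \<in> vertex_set G L" "v \<in> vertex_set G F2"
    using L_meets_F[OF L F(1)] L_meets_F[OF L F(2)] by blast
  obtain vs es where q: "is_path G vs es" "hd vs = u" "last vs = v"
    using connected_edges_path[OF cycle_connected[OF cyc(1)] cycle_edges[OF cyc(1)] finite_G uv(1,3)] by metis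
  have q2: "hd vs \<in> vertex_set G F1" "last vs \<in> vertex_set G F2" using q uv by auto
  obtain ws fs where p: "is_path G ws fs" "set ws \<inter> vertex_set G F1 = {hd ws}"
    "set ws \<inter> vertex_set G F2 = {last ws}"
    using path_minimal[OF q(1) q2 F(3)] by metis
  have l: "is_loose_handcuff G F1 F2 (F1 \<union> F2 \<union> set fs)"
    unfolding is_loose_handcuff_def using cyc F(3) p by blast
  then have c: "matroid_circuit M (F1 \<union> F2 \<union> set fs)"
    unfolding circuit_iff quasi_biased_circuit_def using F by blast
  have "hd ws \<noteq> last ws" using p(2,3) F(3) by blast
  then have "fs \<noteq> []" using path_hd_eq_last[OF p(1)] by simp
  then have e: "hd fs \<in> set fs" by simp
  have "hd fs \<notin> F1 \<union> F2"
  proof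
    assume "hd fs \<in> F1 \<union> F2"
    then have "ends G (hd fs) \<subseteq> set ws \<inter> vertex_set G F1 \<or> ends G (hd fs) \<subseteq> set ws \<inter> vertex_set G F2"
      using path_ends_in_set[OF p(1) e] unfolding vertex_set_def by blast
    then have "card (ends G (hd fs)) \<le> 1"
      unfolding p(2,3) using card_mono[of "{_}" "ends G (hd fs)"] by fastforce
    then show False using path_edge_card[OF p(1) e] by simp
  qed
  then have "F1 \<union> F2 \<subset> F1 \<union> F2 \<union> set fs" using e by blast
  then show ?thesis using c unfolding matroid_circuit_def by blast
qed

text \<open>If \<open>F2\<close> avoided \<open>X\<close>, a crossing cycle could be formed from
  parts of \<open>L1\<close>, \<open>L2\<close> and of arcs of \<open>F1\<close> and
  \<open>F2\<close> linking them. It would have too few edges outside \<open>X\<close> for the bound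
  in \<open>crossing_cycle_hamiltonian\<close>.\<close>

lemma F_meets_side:
  assumes L: "L1 \<in> \<L>" "L2 \<in> \<L>" "vertex_disjoint G L1 L2" "L1 \<subseteq> X" "L2 \<subseteq> X"
    and F: "F1 \<in> \<F>" "F2 \<in> \<F>" "vertex_disjoint G F1 F2"
  shows "F2 \<inter> X \<noteq> {}"
proof
  assume F2X: "F2 \<inter> X = {}"
  have link: "\<exists>ws fs. is_path G ws fs \<and> set fs \<subseteq> F \<and> fs \<noteq> [] \<and> set ws \<inter> vertex_set G L1 = {hd ws}
      \<and> set ws \<inter> vertex_set G L2 = {last ws}" if F: "F \<in> \<F>" for F
  proof -
    have cyc: "is_cycle G F" using F cycle_if_class by blast
    obtain u v where uv: "u \<in> vertex_set G F" "u \<in> vertex_set G L1" "v \<in> vertex_set G F" "v \<in> vertex_set G L2"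
      using L_meets_F[OF L(1) F] L_meets_F[OF L(2) F] by blast
    obtain vs es where q: "is_path G vs es" "set es \<subseteq> F" "hd vs = u" "last vs = v"
      using connected_edges_path[OF cycle_connected[OF cyc] cycle_edges[OF cyc] finite_G uv(1,3)] .
    have q2: "hd vs \<in> vertex_set G L1" "last vs \<in> vertex_set G L2" using q uv by auto
    obtain ws fs where p: "is_path G ws fs" "set fs \<subseteq> set es" "set ws \<inter> vertex_set G L1 = {hd ws}"
      "set ws \<inter> vertex_set G L2 = {last ws}" using path_minimal[OF q(1) q2 L(3)] .
    have "hd ws \<noteq> last ws" using p(3,4) L(3) by blast
    then have "fs \<noteq> []" using path_hd_eq_last[OF p(1)] by simp
    then show ?thesis using p q(2) by blast
  qed
  obtain ws1 fs1 where 1: "is_path G ws1 fs1" "set fs1 \<subseteq> F1" "fs1 \<noteq> []"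
    "set ws1 \<inter> vertex_set G L1 = {hd ws1}" "set ws1 \<inter> vertex_set G L2 = {last ws1}"
    using link[OF F(1)] by blast
  obtain ws2 fs2 where 2: "is_path G ws2 fs2" "set fs2 \<subseteq> F2" "fs2 \<noteq> []"
    "set ws2 \<inter> vertex_set G L1 = {hd ws2}" "set ws2 \<inter> vertex_set G L2 = {last ws2}"
    using link[OF F(2)] by blast
  have cyc: "is_cycle G L1" "is_cycle G L2" "is_cycle G F1" "is_cycle G F2"
    using L F cycle_if_class by auto
  have V1: "vertex_set G (set fs1) = set ws1" "set ws1 \<subseteq> vertex_set G F1"
    using path_vertex_set[OF 1(1,3)] vertex_set_mono[OF 1(2), of G] by auto
  have V2: "vertex_set G (set fs2) = set ws2" "set ws2 \<subseteq> vertex_set G F2"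
    using path_vertex_set[OF 2(1,3)] vertex_set_mono[OF 2(2), of G] by auto
  define S where "S = L1 \<union> set fs1 \<union> L2"
  have SE: "S \<subseteq> E" unfolding S_def using cycle_edges cyc path_edges[OF 1(1)] by blast
  have "vertex_set G L1 \<inter> vertex_set G (set fs1) \<noteq> {}" using 1(4) V1(1) by blast
  note c1 = connected_edges_Un[OF cycle_connected[OF cyc(1)] path_connected[OF 1(1)] this]
  have "vertex_set G (L1 \<union> set fs1) \<inter> vertex_set G L2 \<noteq> {}" unfolding vertex_set_Un V1(1) using 1(5) by blast
  then have S: "connected_edges G S"
    unfolding S_def by (rule connected_edges_Un[OF c1 cycle_connected[OF cyc(2)]])
  \<comment> \<open>The arcs of \<open>F1\<close> and \<open>F2\<close> share no vertex, so the
    second arc is an ear of \<open>S\<close>.\<close>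
  have "set ws2 \<inter> set ws1 = {}" using V1 V2 F(3) by blast
  then have ear: "set ws2 \<inter> vertex_set G S = {hd ws2, last ws2}"
    unfolding S_def vertex_set_Un V1(1) using 2(4,5) by blast
  have F12: "F1 \<inter> F2 = {}"
    by (rule vertex_disjoint_edges_disjoint[OF finite_G F(3) cycle_edges[OF cyc(3)]])
  then have disj: "set fs2 \<inter> S = {}" unfolding S_def using 1(2) 2(2) F2X L(4,5) by blast
  obtain us gs where g: "is_path G us gs" "set gs \<subseteq> S" "gs \<noteq> []" "hd us = hd ws2"
    "is_cycle G (set gs \<union> set fs2)" using cycle_of_ear[OF S SE finite_G 2(1,3) ear disj] .
  define D where "D = set gs \<union> set fs2"
  \<comment> \<open>The first edge of \<open>gs\<close> starts at \<open>hd ws2\<close>, a vertex of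
    \<open>F2\<close> and so not of \<open>F1\<close>; hence it comes from \<open>L1\<close> or
    \<open>L2\<close>.\<close>
  have "gs ! 0 \<in> X"
  proof -
    have "gs ! 0 \<in> set gs" "hd us \<in> ends G (gs ! 0)"
      using g(3) path_ends_nth[OF g(1), of 0] path_hd[OF g(1)] by auto
    moreover have "hd us \<notin> vertex_set G F1" using g(4) 2(4) V2 F(3) by blast
    ultimately have "gs ! 0 \<notin> F1" "gs ! 0 \<in> S" using g(2) unfolding vertex_set_def by blast+
    then show ?thesis unfolding S_def using 1(2) L(4,5) by blast
  qed
  moreover have "gs ! 0 \<in> D" unfolding D_def using g(3) by simp
  moreover have "hd fs2 \<in> D" "hd fs2 \<notin> X" unfolding D_def using 2(2,3) F2X by (auto dest: hd_in_set)
  ultimately have "crossing D" unfolding crossing_def by blast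
  then have le: "matroid_rank M (E - X) \<le> card (D - X)"
    using crossing_cycle_hamiltonian(2)[OF L] g(5) unfolding D_def by blast
  \<comment> \<open>\<open>fs2\<close> lists the edges of a path, so it misses some edge
    \<open>h\<close> of the cycle \<open>F2\<close>.\<close>
  have "set fs2 \<noteq> F2"
    using no_pendant_path_empty[OF 2(1) cycle_no_pendant[OF cyc(4)]] cycle_nonempty[OF cyc(4)] by blast
  then obtain h where h: "h \<in> F2" "h \<notin> set fs2" using 2(2) by blast
  have FE: "F1 \<union> F2 \<subseteq> E" using cycle_edges cyc by blast
  have DX: "D - X \<subseteq> (F1 \<union> F2 - X) - {h}"
  proof -
    have gsub: "set gs \<subseteq> X \<union> F1" using g(2) 1(2) L(4,5) unfolding S_def by blast
    then have "D - X \<subseteq> F1 \<union> F2 - X" unfolding D_def using 2(2) by blast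
    moreover have "h \<notin> D" unfolding D_def using h gsub F2X F12 by blast
    ultimately show ?thesis by blast
  qed
  have fin: "finite (F1 \<union> F2 - X)"
    by (rule finite_Diff[OF finite_subset[OF FE finite_E]])
  have "h \<in> F1 \<union> F2 - X" using h F2X by blast
  \<comment> \<open>The independent set \<open>F1 \<union> F2 - X\<close> bounds the rank of
    \<open>E - X\<close> from below, and it contains \<open>h\<close>, which is not in
    \<open>D\<close>.\<close>
  have "card (D - X) \<le> card ((F1 \<union> F2 - X) - {h})" by (rule card_mono[OF finite_Diff[OF fin] DX])
  also have "\<dots> < card (F1 \<union> F2 - X)" by (rule card_Diff1_less[OF fin]) fact
  also have "\<dots> \<le> matroid_rank M (E - X)"
    by (rule card_le_rank[OF indep_subset[OF disjoint_F_pair_indep[OF F] Diff_subset] Diff_mono[OF FE order_refl]])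
  finally show False using le by simp
qed

text \<open>A cycle of \<open>\<F>\<close> that is disjoint from another one cannot cross, because
  crossing cycles pass through all vertices; as it meets \<open>X\<close> by
  \<open>F_meets_side\<close>, it lies inside \<open>X\<close>. With both \<open>F1\<close> and
  \<open>F2\<close> inside \<open>X\<close>, the existence and the exclusion of a crossing cycle
  collide.\<close>

lemma L_pair_not_inside:
  assumes L: "L1 \<in> \<L>" "L2 \<in> \<L>" "vertex_disjoint G L1 L2" "L1 \<subseteq> X" "L2 \<subseteq> X"
  shows False
proof -
  obtain F1 F2 where F: "F1 \<in> \<F>" "F2 \<in> \<F>" "vertex_disjoint G F1 F2"
    using nondegenerate_F unfolding degenerate_def by blast
  have inside: "C \<subseteq> X" if C: "C \<in> \<F>" "D \<in> \<F>" "vertex_disjoint G C D" for C D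
  proof -
    have cyc: "is_cycle G C" "is_cycle G D" using C cycle_if_class by auto
    have "vertex_set G D \<noteq> {}" using L_meets_F[OF L(1) C(2)] by blast
    moreover have "vertex_set G D \<subseteq> V" by (intro vertex_set_mono cycle_edges cyc)
    ultimately have "\<not> crossing C" using crossing_cycle_hamiltonian(1)[OF L cyc(1)] C(3) by blast
    moreover have "C \<inter> X \<noteq> {}" using F_meets_side[OF L C(2,1)] C(3) by (simp add: inf_commute)
    ultimately show ?thesis unfolding crossing_def by blast
  qed
  have "F1 \<subseteq> X" "F2 \<subseteq> X" using inside[OF F] inside[OF F(2,1)] F(3) by (auto simp: inf_commute)
  then show False
    using crossing_cycle_exists[OF L F] no_crossing_cycle_if_all_inside[OF L F] by blast
qed

end

theorem theorem1p7:
  fixes G :: "('v, 'e) multigraph"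
    and \<B> \<L> \<F> :: "'e set set"
    and M :: "'e pre_matroid"
  assumes "quasi_biased_graph G \<B> \<L> \<F>"
    and "\<not> degenerate G \<L>"
    and "\<not> degenerate G \<F>"
    and "is_quasi_biased_matroid G \<B> \<L> \<F> M"
    and "simple_matroid M"
    and "connected_matroid M"
    and "\<not> n_connected_matroid 3 M"
  shows "\<not> unbreakable_matroid M"
proof
  assume ub: "unbreakable_matroid M"
  have m: "matroid M" using assms(4) unfolding is_quasi_biased_matroid_def by simp
  obtain X where X: "matroid_separation M 2 X" using matroid.not_3_connectedE[OF m assms(6,7)] .
  interpret S: quasi_biased_2_separation M G \<B> \<L> \<F> X
    by (intro quasi_biased_2_separation.intro quasi_biased_2_separation_axioms.intro m assms ub X)
  \<comment> \<open>A disjoint pair of cycles of \<open>\<L>\<close> may lie on either side, so the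
    lemmas are also instantiated for the complement of \<open>X\<close>.\<close>
  interpret S': quasi_biased_2_separation M G \<B> \<L> \<F> "edges G - X" by (rule S.swap_sides)
  obtain L1 L2 where L: "L1 \<in> \<L>" "L2 \<in> \<L>" "vertex_disjoint G L1 L2"
    using assms(2) unfolding degenerate_def by blast
  have "L1 \<union> L2 \<subseteq> edges G" using L cycle_edges S.cycle_if_class by blast
  then have "L1 \<union> L2 \<subseteq> X \<or> L1 \<union> L2 \<subseteq> edges G - X"
    using S.L_pair_not_crossing[OF L] unfolding S.crossing_def by blast
  then show False using S.L_pair_not_inside[OF L] S'.L_pair_not_inside[OF L] by auto
qed

end
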